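(* Let $d\ge 1$ be an integer, let $1\le p\le\infty$, and let $\|\cdot\|$ be the $l^p$-norm on $\mathbb{R}^d$. Let $f$ be a bounded probability density function on $\mathbb{R}^d$, let $X_1,X_2,\dots$ be i.i.d. random vectors in $\mathbb{R}^d$ with density $f$, and let $(r_n)$ be a sequence of positive reals with $r_n\to 0$. Let $G_n=G(\mathcal{X}_n,r_n)$ be the random geometric graph on $\mathcal{X}_n=\{X_1,\dots,X_n\}$. Let $l\ge 1$ be a fixed integer and suppose that $n^{-\varepsilon}\ll nr_n^d\ll\ln n$ for all $\varepsilon>0$, i.e. $nr_n^d/\ln n\to 0$ and, for every $\varepsilon>0$, $n^{-\varepsilon}/(nr_n^d)\to 0$ as $n\to\infty$. Then $$\frac{\chi_l(G_n)}{\chi(G_n)}\longrightarrow 1\qquad\text{almost surely as } n\to\infty.$$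
   Context: The random geometric graph $G(\mathcal{X}_n,r_n)$ has vertex set $\mathcal{X}_n=\{X_1,\dots,X_n\}$, and for $i\ne j$ the vertices $X_i,X_j$ are adjacent if and only if $\|X_i-X_j\|<r_n$. All graphs $G_n$ are built from the same i.i.d. sequence $X_1,X_2,\dots$. For a graph $G$, $\chi(G)$ is the chromatic number and $d_G(u,v)$ is the graph distance (length of a shortest path, $\infty$ if $u,v$ lie in different components). For an integer $l\ge 1$, a distant-$l$ coloring of $G$ is a coloring of the vertices such that any two distinct vertices $u,v$ with $d_G(u,v)\le l$ receive different colors. The distant-$l$ chromatic number $\chi_l(G)$ is the least number of colors in a distant-$l$ coloring of $G$; equivalently $\chi_l(G)=\chi(G^l)$, where $G^l$ has the same vertex set as $G$ and two distinct vertices are adjacent iff their graph distance in $G$ is at most $l$. *)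

theory Defs
  imports "HOL-Probability.Probability"
begin

definition lp_norm :: "ereal \<Rightarrow> real ^ 'd \<Rightarrow> real" where
  "lp_norm p x =
     (if p = \<infinity> then infnorm x
      else (\<Sum>i\<in>UNIV. \<bar>x $ i\<bar> powr real_of_ereal p) powr (1 / real_of_ereal p))"

text \<open>
  A simple graph is given by a vertex set \<open>V\<close> and a symmetric, irreflexive adjacency
  relation \<open>E\<close>, of which only the restriction to \<open>V\<close> matters.
\<close>

definition proper_coloring :: "'v set \<Rightarrow> ('v \<Rightarrow> 'v \<Rightarrow> bool) \<Rightarrow> ('v \<Rightarrow> nat) \<Rightarrow> bool" where
  "proper_coloring V E c \<longleftrightarrow> (\<forall>u\<in>V. \<forall>v\<in>V. E u v \<longrightarrow> c u \<noteq> c v)"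

text \<open>
  The two chromatic numbers below are meant for finite \<open>V\<close>; then some \<open>k\<close> always qualifies.
\<close>

definition chromatic_number :: "'v set \<Rightarrow> ('v \<Rightarrow> 'v \<Rightarrow> bool) \<Rightarrow> nat" where
  "chromatic_number V E = (LEAST k. \<exists>c. c ` V \<subseteq> {..<k} \<and> proper_coloring V E c)"

definition graph_path ::
  "'v set \<Rightarrow> ('v \<Rightarrow> 'v \<Rightarrow> bool) \<Rightarrow> 'v \<Rightarrow> 'v list \<Rightarrow> 'v \<Rightarrow> bool" where
  "graph_path V E u vs v \<longleftrightarrow>
     vs \<noteq> [] \<and> set vs \<subseteq> V \<and> distinct vs \<and> successively E vs \<and> hd vs = u \<and> last vs = v"

text \<open>
  The length of a path is its number of edges; the infimum of the empty set in \<^typ>\<open>enat\<close>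
  is \<open>\<infinity>\<close>, which covers vertices in different components.
\<close>

definition graph_dist :: "'v set \<Rightarrow> ('v \<Rightarrow> 'v \<Rightarrow> bool) \<Rightarrow> 'v \<Rightarrow> 'v \<Rightarrow> enat" where
  "graph_dist V E u v = (INF vs \<in> {vs. graph_path V E u vs v}. enat (length vs - 1))"

definition distant_coloring ::
  "nat \<Rightarrow> 'v set \<Rightarrow> ('v \<Rightarrow> 'v \<Rightarrow> bool) \<Rightarrow> ('v \<Rightarrow> nat) \<Rightarrow> bool" where
  "distant_coloring l V E c \<longleftrightarrow>
     (\<forall>u\<in>V. \<forall>v\<in>V. u \<noteq> v \<and> graph_dist V E u v \<le> enat l \<longrightarrow> c u \<noteq> c v)"

definition distant_chromatic_number :: "nat \<Rightarrow> 'v set \<Rightarrow> ('v \<Rightarrow> 'v \<Rightarrow> bool) \<Rightarrow> nat" where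
  "distant_chromatic_number l V E =
     (LEAST k. \<exists>c. c ` V \<subseteq> {..<k} \<and> distant_coloring l V E c)"

text \<open>
  The vertices of a random geometric graph are the sample points themselves. Sample points
  that coincide give a single vertex; for samples from a density this has probability zero.
\<close>

definition rgg_verts :: "(nat \<Rightarrow> 'w \<Rightarrow> real ^ 'd) \<Rightarrow> nat \<Rightarrow> 'w \<Rightarrow> (real ^ 'd) set" where
  "rgg_verts X n \<omega> = (\<lambda>i. X i \<omega>) ` {1..n}"

definition rgg_adj :: "ereal \<Rightarrow> real \<Rightarrow> real ^ 'd \<Rightarrow> real ^ 'd \<Rightarrow> bool" where
  "rgg_adj p \<rho> x y \<longleftrightarrow> x \<noteq> y \<and> lp_norm p (x - y) < \<rho>"

end

theory Submission
  imports Defs "HOL-Real_Asymp.Real_Asymp"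
begin

text \<open>
  Both chromatic numbers are squeezed between two counts of sample points. A set of points with
  pairwise distance below \<open>r\<close> is a clique, so \<open>\<chi>\<close> is at least the number of points in any cell of
  side \<open>r / d\<close>. Vertices at graph distance at most \<open>l\<close> are within \<open>l r\<close> of each other in the
  maximum norm, so greedy coloring bounds \<open>\<chi>\<^sub>l\<close> by the largest number of points in a ball of
  radius \<open>l r\<close>. In the sparse regime the maximal occupancy does not notice the constant in front
  of \<open>r\<close>: with \<open>t = ln n / (n r^d)\<close>, it is asymptotic to \<open>k = ln n / ln t\<close> at every scale \<open>c r\<close>.
  Indeed the expected number of \<open>m\<close>-point clusters at scale \<open>c r\<close> is of order
  \<open>n (C n r^d / m)^m\<close>, and for \<open>m\<close> comparable to \<open>k\<close> the base \<open>C n r^d / m\<close> is of order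
  \<open>ln t / t\<close>, that is, \<open>t\<close> to the power \<open>- 1 + o(1)\<close> whatever \<open>C\<close> is; since \<open>t powr k = n\<close>, the
  threshold sits at \<open>m = (1 + o(1)) k\<close>.

  The upper bound on the occupancy is a first moment estimate (\<open>prob_crowded_ball_le\<close>). For the
  lower bound the sample is cut into \<open>m\<close> groups and one asks for a grid cell that is hit by every
  group. This costs only a factor \<open>exp m\<close>, which is negligible here, and it makes the events of two
  distinct cells negatively correlated, so that a second moment estimate applies
  (\<open>prob_no_crowded_cell_le\<close>). It needs many cells of mass comparable to the volume; they exist by
  pigeonhole for every distribution with bounded density (\<open>ex_heavy_cells\<close>).

  Both failure probabilities are only bounded by \<open>n powr (- \<epsilon> / 2)\<close> up to logarithms, which is not
  summable over \<open>n\<close>. However, both counts are monotone in \<open>n\<close> and in the radius, and constants in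
  front of \<open>n\<close> and \<open>r\<close> are harmless, so it suffices to control one event for each dyadic cell
  \<open>2^j \<le> n \<le> 2^(j+1)\<close>, \<open>2^(-i-1) \<le> r \<le> 2^(-i)\<close>. For a given \<open>j\<close> at most \<open>2 j + 1\<close> values of \<open>i\<close>
  are compatible with the sparse regime, and then the Borel--Cantelli lemma applies
  (\<open>AE_eventually_focused\<close>). The thresholds are attached to the cell and not to \<open>n\<close>, so the
  function \<open>k\<close> never has to be compared at different arguments.
\<close>

section \<open>The norms and the two chromatic numbers\<close>

lemma infnorm_cart_eq_Max:
  "infnorm (x :: real ^ 'd) = Max (range (\<lambda>i. \<bar>x $ i\<bar>))"
proof -
  have "infnorm x = Sup (range (\<lambda>i. \<bar>x $ i\<bar>))"
    unfolding infnorm_cart by (rule arg_cong[where f = Sup]) auto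
  then show ?thesis by (simp add: cSup_eq_Max)
qed

lemma infnorm_less_iff_cart: "infnorm (x :: real ^ 'd) < s \<longleftrightarrow> (\<forall>i. \<bar>x $ i\<bar> < s)"
  unfolding infnorm_cart_eq_Max by (subst Max_less_iff) auto

lemma infnorm_le_iff_cart: "infnorm (x :: real ^ 'd) \<le> s \<longleftrightarrow> (\<forall>i. \<bar>x $ i\<bar> \<le> s)"
  unfolding infnorm_cart_eq_Max by (subst Max_le_iff) auto

text \<open>
  Only these two comparisons with the maximum norm are needed of the \<open>l\<^sup>p\<close> norm: the dimensional
  constant in the second one is absorbed by the insensitivity of the maximal occupancy to scale.
\<close>

lemma infnorm_le_lp_norm:
  fixes x :: "real ^ 'd"
  assumes "1 \<le> p"
  shows "infnorm x \<le> lp_norm p x"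
proof (cases "p = \<infinity>")
  case False
  then obtain q where q: "p = ereal q" "1 \<le> q"
    using assms by (cases p) auto
  have "\<bar>x $ i\<bar> \<le> lp_norm p x" for i
  proof -
    have "\<bar>x $ i\<bar> = (\<bar>x $ i\<bar> powr q) powr (1 / q)"
      using q by (simp add: powr_powr)
    also have "\<dots> \<le> (\<Sum>i\<in>UNIV. \<bar>x $ i\<bar> powr q) powr (1 / q)"
      using q by (intro powr_mono2 member_le_sum) auto
    finally show ?thesis using q by (simp add: lp_norm_def)
  qed
  then show ?thesis by (simp add: infnorm_le_iff_cart)
qed (simp add: lp_norm_def)

lemma lp_norm_le_infnorm:
  fixes x :: "real ^ 'd"
  assumes "1 \<le> p"
  shows "lp_norm p x \<le> real CARD('d) * infnorm x"
proof (cases "p = \<infinity>")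
  case True
  have "1 * infnorm x \<le> real CARD('d) * infnorm x"
    by (intro mult_right_mono) (auto simp: infnorm_pos_le Suc_le_eq)
  then show ?thesis using True by (simp add: lp_norm_def)
next
  case False
  then obtain q where q: "p = ereal q" "1 \<le> q"
    using assms by (cases p) auto
  have "(\<Sum>i\<in>UNIV. \<bar>x $ i\<bar> powr q) powr (1 / q)
      \<le> (real CARD('d) * infnorm x powr q) powr (1 / q)"
    using q component_le_infnorm_cart[of x]
    by (intro powr_mono2 order_trans[OF sum_bounded_above[where K = "infnorm x powr q"]])
       (auto intro: powr_mono2 sum_nonneg)
  also have "\<dots> = real CARD('d) powr (1 / q) * infnorm x"
    using q by (simp add: powr_mult powr_powr infnorm_pos_le)
  also have "real CARD('d) powr (1 / q) \<le> real CARD('d) powr 1"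
    using q by (intro powr_mono) (auto simp: Suc_le_eq)
  finally show ?thesis
    using q by (simp add: lp_norm_def infnorm_pos_le mult_right_mono)
qed

text \<open>
  When the vertices are colored one after the other, each new vertex sees fewer than \<open>k\<close> forbidden
  colors.
\<close>

lemma greedy_coloring:
  fixes E :: "'v \<Rightarrow> 'v \<Rightarrow> bool"
  assumes "finite V" and sym: "\<And>u v. E u v \<Longrightarrow> E v u"
    and deg: "\<And>u. u \<in> V \<Longrightarrow> card {v \<in> V. v \<noteq> u \<and> E u v} < k"
  shows "\<exists>c. c ` V \<subseteq> {..<k} \<and> (\<forall>u\<in>V. \<forall>v\<in>V. u \<noteq> v \<and> E u v \<longrightarrow> c u \<noteq> c v)"
  using assms(1) deg
proof (induction V)
  case (insert w V)
  have "card {v \<in> V. v \<noteq> u \<and> E u v} < k" if "u \<in> V" for u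
  proof -
    have "card {v \<in> V. v \<noteq> u \<and> E u v} \<le> card {v \<in> insert w V. v \<noteq> u \<and> E u v}"
      using insert.hyps by (intro card_mono) auto
    also have "\<dots> < k" using that by (intro insert.prems) auto
    finally show ?thesis .
  qed
  then have "\<exists>c. c ` V \<subseteq> {..<k} \<and> (\<forall>u\<in>V. \<forall>v\<in>V. u \<noteq> v \<and> E u v \<longrightarrow> c u \<noteq> c v)"
    by (rule insert.IH)
  then obtain c where
    c: "c ` V \<subseteq> {..<k}" "\<And>u v. u \<in> V \<Longrightarrow> v \<in> V \<Longrightarrow> u \<noteq> v \<Longrightarrow> E u v \<Longrightarrow> c u \<noteq> c v"
    by metis
  define N where "N = {v \<in> insert w V. v \<noteq> w \<and> E w v}"
  have "finite N" "card N < k"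
    using insert.hyps insert.prems[of w] by (auto simp: N_def)
  then have "card (c ` N) < card {..<k}"
    by (metis card_image_le card_lessThan le_less_trans)
  then obtain j where j: "j < k" "j \<notin> c ` N"
    by (metis card_mono finite_imageI \<open>finite N\<close> lessThan_iff not_le subsetI)
  show ?case
  proof (intro exI[of _ "c(w := j)"] conjI ballI impI)
    show "(c(w := j)) ` insert w V \<subseteq> {..<k}" using c j by auto
    fix u v assume uv: "u \<in> insert w V" "v \<in> insert w V" "u \<noteq> v \<and> E u v"
    have "c x \<noteq> j" if "x \<in> V" "x \<noteq> w" "E w x" for x
      using that j(2) by (auto simp: N_def)
    then show "(c(w := j)) u \<noteq> (c(w := j)) v"
      using uv c(2) sym[of u v] by (cases "u = w"; cases "v = w") auto
  qed
qed simp

text \<open>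
  Ensures that the minima defining the chromatic numbers are taken over nonempty sets.
\<close>

lemma ex_proper_coloring:
  assumes "finite V" "\<And>v. \<not> E v v"
  shows "\<exists>k c. c ` V \<subseteq> {..<k} \<and> proper_coloring V E c"
proof -
  obtain c :: "'a \<Rightarrow> nat" and k where c: "inj_on c V" "c ` V = {i. i < k}"
    using finite_imp_nat_seg_image_inj_on[OF assms(1)]
    by (metis assms(1) finite_imp_inj_to_nat_seg)
  then have "proper_coloring V E c"
    using assms(2) unfolding proper_coloring_def by (metis inj_onD)
  with c show ?thesis by (intro exI[of _ k] exI[of _ c]) auto
qed

lemma clique_le_chromatic_number:
  assumes "finite V" "\<And>v. \<not> E v v" and "K \<subseteq> V" and "\<And>u v. u \<in> K \<Longrightarrow> v \<in> K \<Longrightarrow> u \<noteq> v \<Longrightarrow> E u v"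
  shows "card K \<le> chromatic_number V E"
proof -
  from ex_proper_coloring[of V E] assms(1,2)
  have "\<exists>k c. c ` V \<subseteq> {..<k} \<and> proper_coloring V E c" by blast
  from LeastI_ex[OF this] obtain c where
    c: "c ` V \<subseteq> {..<chromatic_number V E}" "proper_coloring V E c"
    unfolding chromatic_number_def by blast
  have "inj_on c K"
  proof (rule inj_onI, rule ccontr)
    fix u v assume "u \<in> K" "v \<in> K" "c u = c v" "u \<noteq> v"
    with assms(3,4) c(2) show False unfolding proper_coloring_def by blast
  qed
  moreover have "c ` K \<subseteq> {..<chromatic_number V E}" using c(1) assms(3) by blast
  ultimately show ?thesis using card_inj_on_le[of c K "{..<chromatic_number V E}"] by simp
qed

lemma adjacent_imp_graph_dist_le_1:
  assumes "u \<in> V" "v \<in> V" "u \<noteq> v" "E u v"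
  shows "graph_dist V E u v \<le> enat 1"
  unfolding graph_dist_def
  by (rule INF_lower2[of "[u, v]"]) (use assms in \<open>auto simp: graph_path_def\<close>)

text \<open>
  A finite infimum in \<^typ>\<open>enat\<close> is attained, and the infimum of the empty set is infinite.
\<close>

lemma graph_dist_le_obtains_path:
  assumes "graph_dist V E u v \<le> enat l"
  obtains vs where "graph_path V E u vs v" "length vs - 1 \<le> l"
proof -
  let ?S = "(\<lambda>vs. enat (length vs - 1)) ` {vs. graph_path V E u vs v}"
  have "?S \<noteq> {}"
    using assms unfolding graph_dist_def by (intro notI) (simp only: Inf_enat_def, simp)
  then have "Inf ?S \<in> ?S"
    unfolding Inf_enat_def by (auto intro: LeastI)
  then obtain vs where "graph_path V E u vs v" "graph_dist V E u v = enat (length vs - 1)"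
    unfolding graph_dist_def by auto
  with assms that show ?thesis by auto
qed

lemma chromatic_number_le_distant:
  assumes fin: "finite V" and irr: "\<And>v. \<not> E v v" and l: "1 \<le> l"
  shows "chromatic_number V E \<le> distant_chromatic_number l V E"
proof -
  obtain c :: "'a \<Rightarrow> nat" and k where c: "c ` V \<subseteq> {..<k}" "proper_coloring V (\<noteq>) c"
    using ex_proper_coloring[of V "(\<noteq>)"] fin by blast
  then have "\<exists>k c. c ` V \<subseteq> {..<k} \<and> distant_coloring l V E c"
    unfolding proper_coloring_def distant_coloring_def by blast
  from LeastI_ex[OF this] obtain c where
    c: "c ` V \<subseteq> {..<distant_chromatic_number l V E}" "distant_coloring l V E c"
    unfolding distant_chromatic_number_def by blast
  have "proper_coloring V E c"
    unfolding proper_coloring_def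
  proof (intro ballI impI)
    fix u v assume uv: "u \<in> V" "v \<in> V" "E u v"
    then have "u \<noteq> v" using irr by auto
    with uv have "graph_dist V E u v \<le> enat 1" by (intro adjacent_imp_graph_dist_le_1)
    also have "\<dots> \<le> enat l" using l by simp
    finally show "c u \<noteq> c v" using c(2) uv \<open>u \<noteq> v\<close> by (auto simp: distant_coloring_def)
  qed
  with c(1) show ?thesis
    unfolding chromatic_number_def by (intro Least_le) blast
qed

lemma infnorm_path_le:
  fixes vs :: "(real ^ 'd) list"
  assumes "successively E vs" "vs \<noteq> []" and E: "\<And>x y. E x y \<Longrightarrow> infnorm (x - y) \<le> \<rho>"
  shows "infnorm (hd vs - last vs) \<le> real (length vs - 1) * \<rho>"
  using assms(1,2)
proof (induction vs rule: induct_list012)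
  case (3 x y zs)
  have "infnorm (x - last (y # zs)) \<le> infnorm (x - y) + infnorm (y - last (y # zs))"
    using infnorm_triangle[of "x - y" "y - last (y # zs)"] by simp
  also have "\<dots> \<le> \<rho> + real (length zs) * \<rho>"
    using 3 E by (intro add_mono) auto
  finally show ?case by (simp add: algebra_simps)
qed (auto simp: infnorm_0)

text \<open>
  By the triangle inequality along a path, the graph of the relation \<open>infnorm (v - u) \<le> l \<rho>\<close>
  contains the \<open>l\<close>-th power of the random geometric graph; it is colored greedily.
\<close>

lemma distant_chromatic_number_rgg_le:
  fixes V :: "(real ^ 'd) set"
  assumes p: "1 \<le> p" and fin: "finite V" and \<rho>: "0 \<le> \<rho>"
    and deg: "\<And>u. u \<in> V \<Longrightarrow> card {v \<in> V. v \<noteq> u \<and> infnorm (v - u) \<le> real l * \<rho>} < k"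
  shows "distant_chromatic_number l V (rgg_adj p \<rho>) \<le> k"
proof -
  define E where "E u v \<longleftrightarrow> infnorm (v - u) \<le> real l * \<rho>" for u v :: "real ^ 'd"
  have "\<exists>c. c ` V \<subseteq> {..<k} \<and> (\<forall>u\<in>V. \<forall>v\<in>V. u \<noteq> v \<and> E u v \<longrightarrow> c u \<noteq> c v)"
    by (rule greedy_coloring[OF fin]) (use deg in \<open>auto simp: E_def infnorm_sub\<close>)
  then obtain c where c: "c ` V \<subseteq> {..<k}" "\<forall>u\<in>V. \<forall>v\<in>V. u \<noteq> v \<and> E u v \<longrightarrow> c u \<noteq> c v"
    by blast
  have close: "E u v" if "graph_dist V (rgg_adj p \<rho>) u v \<le> enat l" for u v
  proof -
    from that obtain vs where
      vs: "graph_path V (rgg_adj p \<rho>) u vs v" "length vs - 1 \<le> l"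
      by (rule graph_dist_le_obtains_path)
    have "infnorm (x - y) \<le> \<rho>" if "rgg_adj p \<rho> x y" for x y
      using that infnorm_le_lp_norm[OF p, of "x - y"] by (auto simp: rgg_adj_def)
    then have "infnorm (u - v) \<le> real (length vs - 1) * \<rho>"
      using infnorm_path_le[of "rgg_adj p \<rho>" vs \<rho>] vs(1) by (auto simp: graph_path_def)
    also have "\<dots> \<le> real l * \<rho>"
      using vs(2) \<rho> by (intro mult_right_mono) auto
    finally show ?thesis by (simp add: E_def infnorm_sub)
  qed
  have "distant_coloring l V (rgg_adj p \<rho>) c"
    using c(2) close by (auto simp: distant_coloring_def)
  with c(1) show ?thesis
    unfolding distant_chromatic_number_def by (intro Least_le) blast
qed

lemma card_le_chromatic_number_rgg:
  fixes V :: "(real ^ 'd) set"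
  assumes p: "1 \<le> p" and fin: "finite V" and "K \<subseteq> V"
    and K: "\<And>x y. x \<in> K \<Longrightarrow> y \<in> K \<Longrightarrow> real CARD('d) * infnorm (x - y) < \<rho>"
  shows "card K \<le> chromatic_number V (rgg_adj p \<rho>)"
proof (rule clique_le_chromatic_number[OF fin _ \<open>K \<subseteq> V\<close>])
  fix x y assume xy: "x \<in> K" "y \<in> K" "x \<noteq> y"
  have "lp_norm p (x - y) \<le> real CARD('d) * infnorm (x - y)" by (rule lp_norm_le_infnorm[OF p])
  also have "\<dots> < \<rho>" using K xy by blast
  finally show "rgg_adj p \<rho> x y" using xy by (simp add: rgg_adj_def)
qed (simp add: rgg_adj_def)

section \<open>Second moments and an abstract sample\<close>

text \<open>
  Chebyshev's inequality for the number \<open>W\<close> of events that occur. Negative correlation makes the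
  variance of \<open>W\<close> at most its mean \<open>\<mu>\<close>, so \<open>W = 0\<close> has probability at most \<open>\<mu> / \<mu>\<^sup>2\<close>.
\<close>

lemma (in prob_space) prob_none_le_inverse_expectation:
  assumes fin: "finite T" and E: "\<And>k. k \<in> T \<Longrightarrow> E k \<in> events"
    and neg: "\<And>k k'. k \<in> T \<Longrightarrow> k' \<in> T \<Longrightarrow> k \<noteq> k' \<Longrightarrow> prob (E k \<inter> E k') \<le> prob (E k) * prob (E k')"
    and pos: "0 < (\<Sum>k\<in>T. prob (E k))"
  shows "prob (space M - (\<Union>k\<in>T. E k)) \<le> 1 / (\<Sum>k\<in>T. prob (E k))"
proof -
  define \<mu> where "\<mu> = (\<Sum>k\<in>T. prob (E k))"
  define N where "N = space M - (\<Union>k\<in>T. E k)"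
  have [measurable]: "N \<in> events" unfolding N_def using fin E by auto
  let ?W = "\<lambda>\<omega>. \<Sum>k\<in>T. indicator (E k) \<omega> :: real"
  let ?W2 = "\<lambda>\<omega>. \<Sum>k\<in>T. \<Sum>k'\<in>T. indicator (E k \<inter> E k') \<omega> :: real"
  have int: "integrable M (indicator A :: _ \<Rightarrow> real)" if "A \<in> events" for A
    using that by (simp add: integrable_indicator_iff emeasure_eq_measure)
  have ind: "expectation (indicator A) = prob A" if "A \<in> events" for A
    using that by (simp add: sets.Int_space_eq2)
  have intW: "integrable M ?W" by (intro Bochner_Integration.integrable_sum int E)
  have intW2: "integrable M ?W2"
    by (intro Bochner_Integration.integrable_sum int sets.Int E)
  have EW: "expectation ?W = \<mu>"
  proof -
    have "expectation ?W = (\<Sum>k\<in>T. expectation (indicator (E k)))"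
      by (intro Bochner_Integration.integral_sum int E)
    also have "\<dots> = \<mu>"
      unfolding \<mu>_def by (intro sum.cong refl ind) (use E in auto)
    finally show ?thesis .
  qed
  have EW2: "expectation ?W2 = (\<Sum>k\<in>T. \<Sum>k'\<in>T. prob (E k \<inter> E k'))"
  proof -
    have "expectation ?W2 = (\<Sum>k\<in>T. expectation (\<lambda>\<omega>. \<Sum>k'\<in>T. indicator (E k \<inter> E k') \<omega>))"
      by (intro Bochner_Integration.integral_sum Bochner_Integration.integrable_sum int sets.Int E)
    also have "\<dots> = (\<Sum>k\<in>T. \<Sum>k'\<in>T. expectation (indicator (E k \<inter> E k')))"
      by (intro sum.cong refl Bochner_Integration.integral_sum int sets.Int E)
    also have "\<dots> = (\<Sum>k\<in>T. \<Sum>k'\<in>T. prob (E k \<inter> E k'))"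
      by (intro sum.cong refl ind) (use E in auto)
    finally show ?thesis .
  qed
  have "(\<Sum>k'\<in>T. prob (E k \<inter> E k')) \<le> prob (E k) + prob (E k) * \<mu>" if k: "k \<in> T" for k
  proof -
    have "(\<Sum>k'\<in>T. prob (E k \<inter> E k'))
        \<le> (\<Sum>k'\<in>T. (if k' = k then prob (E k) else 0) + prob (E k) * prob (E k'))"
      using k neg by (intro sum_mono) auto
    also have "\<dots> = prob (E k) + prob (E k) * \<mu>"
      using k fin by (simp add: sum.distrib sum_distrib_left \<mu>_def)
    finally show ?thesis .
  qed
  then have "expectation ?W2 \<le> (\<Sum>k\<in>T. prob (E k) + prob (E k) * \<mu>)"
    unfolding EW2 by (intro sum_mono)
  also have "\<dots> = \<mu> + \<mu> * \<mu>"
    by (simp add: sum.distrib \<mu>_def sum_distrib_right)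
  finally have W2: "expectation ?W2 \<le> \<mu> + \<mu> * \<mu>" .
  \<comment> \<open>The indicator of \<open>W = 0\<close> is at most \<open>(1 - W / \<mu>)\<^sup>2\<close>.\<close>
  have "prob N = expectation (indicator N)" by simp
  also have "\<dots> \<le> expectation (\<lambda>\<omega>. 1 - 2 / \<mu> * ?W \<omega> + ?W2 \<omega> / \<mu>\<^sup>2)"
  proof (rule integral_mono[OF int])
    show "integrable M (\<lambda>\<omega>. 1 - 2 / \<mu> * ?W \<omega> + ?W2 \<omega> / \<mu>\<^sup>2)"
      by (intro Bochner_Integration.integrable_add Bochner_Integration.integrable_diff
          integrable_mult_right integrable_divide intW intW2) auto
    fix \<omega> assume "\<omega> \<in> space M"
    have sq: "?W2 \<omega> = (?W \<omega>)\<^sup>2"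
      by (simp add: power2_eq_square sum_product indicator_inter_arith)
    then have *: "1 - 2 / \<mu> * ?W \<omega> + ?W2 \<omega> / \<mu>\<^sup>2 = (1 - ?W \<omega> / \<mu>)\<^sup>2"
      by (simp add: power2_eq_square algebra_simps)
    show "indicator N \<omega> \<le> 1 - 2 / \<mu> * ?W \<omega> + ?W2 \<omega> / \<mu>\<^sup>2"
    proof (cases "\<omega> \<in> N")
      case True
      then have "?W \<omega> = 0" by (auto simp: N_def)
      moreover from this have "?W2 \<omega> = 0" unfolding sq by simp
      ultimately show ?thesis using True by (simp only:) simp
    next
      case False
      then show ?thesis unfolding * by simp
    qed
  qed auto
  also have "\<dots> = 1 - 2 / \<mu> * \<mu> + expectation ?W2 / \<mu>\<^sup>2"
    using intW intW2 EW prob_space by simp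
  also have "\<dots> \<le> 1 - 2 / \<mu> * \<mu> + (\<mu> + \<mu> * \<mu>) / \<mu>\<^sup>2"
    using W2 by (intro add_left_mono divide_right_mono) auto
  also have "\<dots> = 1 / \<mu>"
    using pos by (simp add: \<mu>_def[symmetric] power2_eq_square field_simps)
  finally show ?thesis by (simp add: N_def \<mu>_def)
qed

locale iid_sample = prob_space M + P: prob_space P
  for M :: "'w measure" and P :: "(real ^ 'd) measure" +
  fixes X :: "nat \<Rightarrow> 'w \<Rightarrow> real ^ 'd"
  assumes X_indep: "indep_vars (\<lambda>_. borel) X {1..}"
    and X_distr: "\<And>a. 1 \<le> a \<Longrightarrow> distr M borel (X a) = P"
begin

lemma sets_P [measurable_cong]: "sets P = sets borel"
  using X_distr[of 1] by (metis le_refl sets_distr)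

lemma space_P [simp]: "space P = UNIV"
  using sets_eq_imp_space_eq[OF sets_P] by simp

lemma X_measurable: "1 \<le> a \<Longrightarrow> X a \<in> borel_measurable M"
  using X_indep by (simp add: indep_vars_def)

lemma prob_X_in: "1 \<le> a \<Longrightarrow> A \<in> sets borel \<Longrightarrow> prob (X a -` A \<inter> space M) = measure P A"
  using measure_distr[OF X_measurable, of a A] by (simp add: X_distr)

lemma prob_avoid:
  assumes "finite J" "J \<subseteq> {1..}" "A \<in> sets borel"
  shows "prob {\<omega>\<in>space M. \<forall>a\<in>J. X a \<omega> \<notin> A} = (1 - measure P A) ^ card J"
proof (cases "J = {}")
  case True
  then show ?thesis by (simp add: prob_space)
next
  case False
  have "{\<omega>\<in>space M. \<forall>a\<in>J. X a \<omega> \<notin> A} = (\<Inter>a\<in>J. X a -` (- A) \<inter> space M)"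
    using False by auto
  also have "prob \<dots> = (\<Prod>a\<in>J. prob (X a -` (- A) \<inter> space M))"
    using assms False by (intro indep_varsD[OF X_indep]) auto
  also have "\<dots> = (\<Prod>a\<in>J. measure P (- A))"
    using assms by (intro prod.cong refl prob_X_in) auto
  also have "measure P (- A) = 1 - measure P A"
    using P.prob_compl[of A] assms by (simp add: sets_P Compl_eq_Diff_UNIV)
  finally show ?thesis by simp
qed

lemma avoid_measurable:
  assumes "finite J" "J \<subseteq> {1..}" "A \<in> sets borel"
  shows "{\<omega>\<in>space M. \<forall>a\<in>J. X a \<omega> \<notin> A} \<in> events"
proof -
  have "{\<omega>\<in>space M. X a \<omega> \<notin> A} \<in> events" if "a \<in> J" for a
  proof -
    have "X a -` (- A) \<inter> space M \<in> events"
      using that assms by (intro measurable_sets[OF X_measurable]) auto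
    then show ?thesis by (simp add: vimage_def Int_def conj_commute)
  qed
  then show ?thesis using assms by (intro sets.sets_Collect_finite_All) auto
qed

text \<open>
  A group of points that hits one of two disjoint sets is less likely to hit the other one: by
  inclusion and exclusion this is the inequality \<open>1 - a - b \<le> (1 - a) (1 - b)\<close> raised to the power
  of the group size.
\<close>

lemma prob_hit_both_le:
  assumes J: "finite J" "J \<subseteq> {1..}" and A: "A \<in> sets borel" and B: "B \<in> sets borel"
    and disj: "A \<inter> B = {}"
  shows "prob {\<omega>\<in>space M. (\<exists>a\<in>J. X a \<omega> \<in> A) \<and> (\<exists>a\<in>J. X a \<omega> \<in> B)}
    \<le> (1 - (1 - measure P A) ^ card J) * (1 - (1 - measure P B) ^ card J)"
proof -
  let ?av = "\<lambda>A. {\<omega>\<in>space M. \<forall>a\<in>J. X a \<omega> \<notin> A}"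
  have m [measurable]: "?av A \<in> events" "?av B \<in> events" "?av (A \<union> B) \<in> events"
    using J A B by (blast intro: avoid_measurable sets.Un)+
  have "{\<omega>\<in>space M. (\<exists>a\<in>J. X a \<omega> \<in> A) \<and> (\<exists>a\<in>J. X a \<omega> \<in> B)} = space M - (?av A \<union> ?av B)"
    by auto
  then have "prob {\<omega>\<in>space M. (\<exists>a\<in>J. X a \<omega> \<in> A) \<and> (\<exists>a\<in>J. X a \<omega> \<in> B)}
    = 1 - prob (?av A \<union> ?av B)"
    using prob_compl m by simp
  also have "prob (?av A \<union> ?av B) = prob (?av A) + prob (?av B) - prob (?av A \<inter> ?av B)"
    by (subst measure_Un3) (use m in \<open>simp_all add: fmeasurable_eq_sets\<close>)
  also have "?av A \<inter> ?av B = ?av (A \<union> B)" by auto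
  also have "1 - (prob (?av A) + prob (?av B) - prob (?av (A \<union> B)))
     = 1 - (1 - measure P A) ^ card J - (1 - measure P B) ^ card J
       + (1 - measure P (A \<union> B)) ^ card J"
    using J A B by (subst (1 2 3) prob_avoid) auto
  also have "measure P (A \<union> B) = measure P A + measure P B"
    using A B disj by (intro P.finite_measure_Union) (auto simp: sets_P)
  also have "(1 - (measure P A + measure P B)) ^ card J
      \<le> ((1 - measure P A) * (1 - measure P B)) ^ card J"
  proof (rule power_mono)
    show "0 \<le> 1 - (measure P A + measure P B)"
      using \<open>measure P (A \<union> B) = measure P A + measure P B\<close> P.prob_le_1[of "A \<union> B"] by simp
  qed (simp add: algebra_simps)
  finally show ?thesis unfolding power_mult_distrib by (simp add: algebra_simps)
qed

text \<open>
  Events determined by disjoint groups of sample points are independent.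
\<close>

lemma prob_groups:
  assumes L: "finite L" and J: "\<And>j. j \<in> L \<Longrightarrow> finite (J j) \<and> J j \<subseteq> {1..}"
    and disj: "disjoint_family_on J L"
    and S: "\<And>j. j \<in> L \<Longrightarrow> S j \<in> sets (PiM (J j) (\<lambda>_. borel))"
  shows "prob {\<omega>\<in>space M. \<forall>j\<in>L. (\<lambda>a\<in>J j. X a \<omega>) \<in> S j}
    = (\<Prod>j\<in>L. prob {\<omega>\<in>space M. (\<lambda>a\<in>J j. X a \<omega>) \<in> S j})"
proof (cases "L = {}")
  case False
  have ind: "indep_vars (\<lambda>j. PiM (J j) (\<lambda>_. borel)) (\<lambda>j \<omega>. restrict (\<lambda>i. X i \<omega>) (J j)) L"
    by (rule indep_vars_restrict[OF X_indep _ disj]) (use J in auto)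
  have "{\<omega>\<in>space M. \<forall>j\<in>L. (\<lambda>a\<in>J j. X a \<omega>) \<in> S j}
      = (\<Inter>j\<in>L. (\<lambda>\<omega>. \<lambda>a\<in>J j. X a \<omega>) -` S j \<inter> space M)"
    using False by auto
  also have "prob \<dots> = (\<Prod>j\<in>L. prob ((\<lambda>\<omega>. \<lambda>a\<in>J j. X a \<omega>) -` S j \<inter> space M))"
    using False L S by (intro indep_varsD_finite[OF ind]) auto
  also have "\<dots> = (\<Prod>j\<in>L. prob {\<omega>\<in>space M. (\<lambda>a\<in>J j. X a \<omega>) \<in> S j})"
    by (intro prod.cong refl arg_cong[where f = prob]) auto
  finally show ?thesis .
qed (simp add: prob_space)

text \<open>
  A cell that is hit by each of the groups \<open>J j\<close> contains at least \<open>card L\<close> points. Asking for such a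
  cell, instead of a cell with \<open>card L\<close> arbitrary points, lets all probabilities factorize over the
  groups, and the negative correlation of two cells is inherited from that within a single group.
\<close>

lemma prob_no_crowded_cell_le:
  fixes Q :: "'k \<Rightarrow> (real ^ 'd) set" and J :: "'j \<Rightarrow> nat set"
  assumes T: "finite T" "T \<noteq> {}" and Q: "\<And>k. k \<in> T \<Longrightarrow> Q k \<in> sets borel"
    and Qdisj: "disjoint_family_on Q T" and q: "\<And>k. k \<in> T \<Longrightarrow> q \<le> measure P (Q k)" "0 < q"
    and L: "finite L" and J: "\<And>j. j \<in> L \<Longrightarrow> finite (J j) \<and> J j \<subseteq> {1..}"
    and Jdisj: "disjoint_family_on J L" and g: "\<And>j. j \<in> L \<Longrightarrow> card (J j) = g" "0 < g"
  shows "{\<omega>\<in>space M. \<forall>k\<in>T. \<exists>j\<in>L. \<forall>a\<in>J j. X a \<omega> \<notin> Q k} \<in> events" (is "?N \<in> _")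
    and "prob {\<omega>\<in>space M. \<forall>k\<in>T. \<exists>j\<in>L. \<forall>a\<in>J j. X a \<omega> \<notin> Q k}
      \<le> 1 / (real (card T) * (1 - (1 - q) ^ g) ^ card L)"
proof -
  have m: "{\<omega>\<in>space M. \<forall>a\<in>J j. X a \<omega> \<notin> Q k} \<in> events" if "j \<in> L" "k \<in> T" for j k
    using that J Q by (intro avoid_measurable) auto
  show N: "?N \<in> events"
    by (rule sets.sets_Collect_finite_All[OF sets.sets_Collect_finite_Ex[OF m L] T(1)])
  define E where "E k = {\<omega>\<in>space M. \<forall>j\<in>L. \<exists>a\<in>J j. X a \<omega> \<in> Q k}" for k
  define v where "v k = 1 - (1 - measure P (Q k)) ^ g" for k
  have E: "E k \<in> events" if "k \<in> T" for k
  proof -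
    have "E k = space M - {\<omega>\<in>space M. \<exists>j\<in>L. \<forall>a\<in>J j. X a \<omega> \<notin> Q k}"
      by (auto simp: E_def)
    also have "\<dots> \<in> events"
      by (rule sets.Diff[OF sets.top sets.sets_Collect_finite_Ex[OF m[OF _ that] L]])
    finally show ?thesis .
  qed
  have v0: "0 \<le> v k" for k
    unfolding v_def by (simp add: power_le_one)
  have prob_E: "prob (E k) = v k ^ card L" if k: "k \<in> T" for k
  proof -
    let ?S = "\<lambda>j. {x \<in> space (PiM (J j) (\<lambda>_. borel)). \<exists>a\<in>J j. x a \<in> Q k}"
    have S: "?S j \<in> sets (PiM (J j) (\<lambda>_. borel))" if "j \<in> L" for j
      using J[OF that] Q[OF k] by (intro sets.sets_Collect_finite_Ex) (auto, measurable)
    have "E k = {\<omega>\<in>space M. \<forall>j\<in>L. (\<lambda>a\<in>J j. X a \<omega>) \<in> ?S j}"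
      by (auto simp: E_def space_PiM)
    also have "prob \<dots> = (\<Prod>j\<in>L. prob {\<omega>\<in>space M. (\<lambda>a\<in>J j. X a \<omega>) \<in> ?S j})"
      using S by (intro prob_groups L J Jdisj) auto
    also have "\<dots> = (\<Prod>j\<in>L. v k)"
    proof (intro prod.cong refl)
      fix j assume j: "j \<in> L"
      have "{\<omega>\<in>space M. (\<lambda>a\<in>J j. X a \<omega>) \<in> ?S j} = space M - {\<omega>\<in>space M. \<forall>a\<in>J j. X a \<omega> \<notin> Q k}"
        by (auto simp: space_PiM)
      then show "prob {\<omega>\<in>space M. (\<lambda>a\<in>J j. X a \<omega>) \<in> ?S j} = v k"
        using prob_compl[OF m[OF j k]] prob_avoid[of "J j" "Q k"] J[OF j] Q[OF k] g(1)[OF j]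
        by (simp add: v_def)
    qed
    finally show ?thesis by simp
  qed
  have neg: "prob (E k \<inter> E k') \<le> prob (E k) * prob (E k')"
    if k: "k \<in> T" and k': "k' \<in> T" and ne: "k \<noteq> k'" for k k'
  proof -
    let ?S = "\<lambda>j. {x \<in> space (PiM (J j) (\<lambda>_. borel)). (\<exists>a\<in>J j. x a \<in> Q k) \<and> (\<exists>a\<in>J j. x a \<in> Q k')}"
    have S: "?S j \<in> sets (PiM (J j) (\<lambda>_. borel))" if "j \<in> L" for j
      using J[OF that] Q[OF k] Q[OF k']
      by (intro sets.sets_Collect_conj sets.sets_Collect_finite_Ex) (auto, measurable)
    have "E k \<inter> E k' = {\<omega>\<in>space M. \<forall>j\<in>L. (\<lambda>a\<in>J j. X a \<omega>) \<in> ?S j}"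
      by (auto simp: E_def space_PiM)
    also have "prob \<dots> = (\<Prod>j\<in>L. prob {\<omega>\<in>space M. (\<lambda>a\<in>J j. X a \<omega>) \<in> ?S j})"
      using S by (intro prob_groups L J Jdisj) auto
    also have "\<dots> \<le> (\<Prod>j\<in>L. v k * v k')"
    proof (intro prod_mono conjI)
      fix j assume j: "j \<in> L"
      have "{\<omega>\<in>space M. (\<lambda>a\<in>J j. X a \<omega>) \<in> ?S j}
          = {\<omega>\<in>space M. (\<exists>a\<in>J j. X a \<omega> \<in> Q k) \<and> (\<exists>a\<in>J j. X a \<omega> \<in> Q k')}"
        by (auto simp: space_PiM)
      also have "prob \<dots> \<le> v k * v k'"
        using prob_hit_both_le[of "J j" "Q k" "Q k'"] J[OF j] Q[OF k] Q[OF k'] g(1)[OF j]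
          disjoint_family_onD[OF Qdisj k k' ne]
        by (simp add: v_def)
      finally show "prob {\<omega>\<in>space M. (\<lambda>a\<in>J j. X a \<omega>) \<in> ?S j} \<le> v k * v k'" .
    qed simp
    also have "\<dots> = prob (E k) * prob (E k')"
      by (simp add: prob_E[OF k] prob_E[OF k'] power_mult_distrib)
    finally show ?thesis .
  qed
  define w where "w = 1 - (1 - q) ^ g"
  obtain k0 where k0: "k0 \<in> T" using T by auto
  have q1: "q \<le> 1" using q(1)[OF k0] P.prob_le_1 order_trans by blast
  have "(1 - q) ^ g < 1"
    using q(2) q1 g(2) power_decreasing[of 1 g "1 - q"] by simp
  then have w: "0 < w" by (simp add: w_def)
  have vw: "w ^ card L \<le> prob (E k)" if k: "k \<in> T" for k
  proof -
    have "w \<le> v k"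
      unfolding w_def v_def using q(1)[OF k] by (intro diff_left_mono power_mono) auto
    then show ?thesis using w by (simp add: prob_E[OF k] power_mono)
  qed
  have sum: "real (card T) * w ^ card L \<le> (\<Sum>k\<in>T. prob (E k))"
    using sum_mono[OF vw, of T "\<lambda>k. k"] by simp
  have pos: "0 < real (card T) * w ^ card L" using T w by (simp add: card_gt_0_iff)
  have "?N = space M - (\<Union>k\<in>T. E k)" unfolding E_def by blast
  also have "prob \<dots> \<le> 1 / (\<Sum>k\<in>T. prob (E k))"
    using sum pos by (intro prob_none_le_inverse_expectation T E neg) auto
  also have "\<dots> \<le> 1 / (real (card T) * w ^ card L)"
    using sum pos by (intro divide_left_mono) auto
  finally show "prob ?N \<le> 1 / (real (card T) * (1 - (1 - q) ^ g) ^ card L)"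
    by (simp add: w_def)
qed

end

section \<open>Crowded balls and heavy grid cells\<close>

text \<open>
  Cells are half-open, so that they are disjoint and points of one cell are strictly closer than the
  side length \<open>\<rho>\<close> in the maximum norm.
\<close>

definition grid_cell :: "real \<Rightarrow> ('d \<Rightarrow> int) \<Rightarrow> (real ^ 'd) set" where
  "grid_cell \<rho> k = {x. \<forall>i. \<lfloor>x $ i / \<rho>\<rfloor> = k i}"

lemma grid_cell_borel [measurable]: "grid_cell \<rho> k \<in> sets borel"
  unfolding grid_cell_def by measurable

lemma disjoint_grid_cells: "disjoint_family_on (grid_cell \<rho>) T"
  unfolding disjoint_family_on_def grid_cell_def by (auto simp: fun_eq_iff)

lemma infnorm_less_in_grid_cell:
  assumes "0 < \<rho>" "x \<in> grid_cell \<rho> k" "y \<in> grid_cell \<rho> k"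
  shows "infnorm (x - y) < \<rho>"
  unfolding infnorm_less_iff_cart
proof
  fix i
  have "\<lfloor>x $ i / \<rho>\<rfloor> = \<lfloor>y $ i / \<rho>\<rfloor>"
    using assms by (simp add: grid_cell_def)
  then have "\<bar>x $ i / \<rho> - y $ i / \<rho>\<bar> < 1" by linarith
  then have "\<bar>x $ i - y $ i\<bar> / \<rho> < 1"
    using assms(1) by (simp add: diff_divide_distrib[symmetric])
  then show "\<bar>(x - y) $ i\<bar> < \<rho>" using assms(1) by (simp add: field_simps)
qed

text \<open>
  Of a bounded density only its consequence for the mass of cubes is used; \<open>F\<close> is taken at least
  \<open>1\<close> so that it can be used as a divisor.
\<close>

locale iid_bounded_sample = iid_sample M P X
  for M :: "'w measure" and P :: "(real ^ 'd) measure" and X :: "nat \<Rightarrow> 'w \<Rightarrow> real ^ 'd" +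
  fixes F :: real
  assumes F: "1 \<le> F"
    and mass_ball_le: "\<And>x s. 0 \<le> s \<Longrightarrow> measure P {y. infnorm (y - x) \<le> s} \<le> F * (2 * s) ^ CARD('d)"
begin

lemma borel_infnorm [measurable]: "(infnorm :: real ^ 'd \<Rightarrow> real) \<in> borel_measurable borel"
  by (intro borel_measurable_continuous_onI continuous_on_infnorm continuous_on_id)

text \<open>
  Conditionally on the position of \<open>X a\<close>, the other points fall independently into a fixed ball;
  this is Fubini's theorem on the product space of the coordinates in \<open>insert a S\<close>.
\<close>

lemma prob_cluster_le:
  assumes S: "finite S" "S \<subseteq> {1..}" and a: "1 \<le> a" "a \<notin> S" and s: "0 \<le> s"
  shows "{\<omega>\<in>space M. \<forall>b\<in>S. infnorm (X b \<omega> - X a \<omega>) \<le> s} \<in> events" (is "?E \<in> _")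
    and "prob {\<omega>\<in>space M. \<forall>b\<in>S. infnorm (X b \<omega> - X a \<omega>) \<le> s}
      \<le> (F * (2 * s) ^ CARD('d)) ^ card S"
proof -
  define c where "c = F * (2 * s) ^ CARD('d)"
  have c0: "0 \<le> c" using F s by (simp add: c_def)
  let ?I = "insert a S"
  let ?B = "PiM ?I (\<lambda>_. borel :: (real ^ 'd) measure)"
  let ?Y = "\<lambda>\<omega>. \<lambda>i\<in>?I. X i \<omega>"
  define C where "C = {x \<in> space ?B. \<forall>b\<in>S. infnorm (x b - x a) \<le> s}"
  have C: "C \<in> sets ?B"
    unfolding C_def using S(1) by (intro sets.sets_Collect_finite_All) (auto, measurable)
  have Y: "?Y \<in> measurable M ?B"
    using S a by (intro measurable_restrict X_measurable) auto
  have E: "?E = ?Y -` C \<inter> space M"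
    by (auto simp: C_def space_PiM)
  then show "?E \<in> events" using measurable_sets[OF Y C] by simp
  have "indep_vars (\<lambda>_. borel) X ?I"
    by (rule indep_vars_subset[OF X_indep]) (use S a in auto)
  then have "distr M ?B ?Y = PiM ?I (\<lambda>i. distr M borel (X i))"
    using S a by (subst (asm) indep_vars_iff_distr_eq_PiM') (auto intro!: X_measurable)
  also have "\<dots> = PiM ?I (\<lambda>_. P)"
    using S a by (intro PiM_cong refl X_distr) auto
  finally have distr: "distr M ?B ?Y = PiM ?I (\<lambda>_. P)" .
  interpret PP: product_sigma_finite "\<lambda>_. P"
    by unfold_locales
  have sets_eq: "sets (PiM I (\<lambda>_. P)) = sets (PiM I (\<lambda>_. borel))" for I :: "nat set"
    by (intro sets_PiM_cong refl sets_P)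
  have C': "C \<in> sets (PiM ?I (\<lambda>_. P))" using C sets_eq by blast
  have "emeasure M ?E = emeasure (PiM ?I (\<lambda>_. P)) C"
    unfolding distr[symmetric] E by (rule emeasure_distr[OF Y C, symmetric])
  also have "\<dots> = (\<integral>\<^sup>+ x. indicator C x \<partial>PiM ?I (\<lambda>_. P))"
    using C' by simp
  also have "\<dots> = (\<integral>\<^sup>+ y. (\<integral>\<^sup>+ x. indicator C (x(a := y)) \<partial>PiM S (\<lambda>_. P)) \<partial>P)"
    using C' S a by (intro PP.product_nn_integral_insert_rev) auto
  also have "\<dots> \<le> (\<integral>\<^sup>+ y. ennreal (c ^ card S) \<partial>P)"
  proof (rule nn_integral_mono)
    fix y :: "real ^ 'd"
    let ?K = "{z. infnorm (z - y) \<le> s}"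
    have K: "?K \<in> sets P" by (simp add: sets_P)
    have "(\<integral>\<^sup>+ x. indicator C (x(a := y)) \<partial>PiM S (\<lambda>_. P))
        = (\<integral>\<^sup>+ x. (\<Prod>b\<in>S. indicator ?K (x b)) \<partial>PiM S (\<lambda>_. P))"
    proof (rule nn_integral_cong)
      fix x assume "x \<in> space (PiM S (\<lambda>_. P))"
      then have x: "x(a := y) \<in> space ?B"
        by (auto simp: space_PiM PiE_def extensional_def)
      show "(indicator C (x(a := y)) :: ennreal) = (\<Prod>b\<in>S. indicator ?K (x b))"
      proof (cases "\<forall>b\<in>S. infnorm (x b - y) \<le> s")
        case True
        then have "x(a := y) \<in> C" using x a by (auto simp: C_def)
        moreover have "(\<Prod>b\<in>S. indicator ?K (x b) :: ennreal) = (\<Prod>b\<in>S. 1)"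
          using True by (intro prod.cong) auto
        ultimately show ?thesis by simp
      next
        case False
        then obtain b where b: "b \<in> S" "x b \<notin> ?K" by auto
        then have "x(a := y) \<notin> C" using a by (auto simp: C_def)
        moreover have "(\<Prod>b\<in>S. indicator ?K (x b) :: ennreal) = 0"
          using S b by (intro prod_zero bexI[of _ b]) auto
        ultimately show ?thesis by simp
      qed
    qed
    also have "\<dots> = (\<Prod>b\<in>S. \<integral>\<^sup>+ z. indicator ?K z \<partial>P)"
      using S K by (intro PP.product_nn_integral_prod) auto
    also have "\<dots> = emeasure P ?K ^ card S" using K by simp
    also have "\<dots> \<le> ennreal c ^ card S"
      using mass_ball_le[OF s, of y]
      by (intro power_mono) (auto simp: P.emeasure_eq_measure c_def intro: ennreal_leI)
    finally show "(\<integral>\<^sup>+ x. indicator C (x(a := y)) \<partial>PiM S (\<lambda>_. P)) \<le> ennreal (c ^ card S)"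
      using c0 by (simp add: ennreal_power)
  qed
  also have "\<dots> = ennreal (c ^ card S)"
    using P.emeasure_space_1 by simp
  finally show "prob ?E \<le> (F * (2 * s) ^ CARD('d)) ^ card S"
    using c0 by (simp add: emeasure_eq_measure c_def)
qed

text \<open>
  The event is expressed through index sets \<open>S\<close> and not through counts of points, which turns it
  into a finite union of the events of the preceding lemma.
\<close>

definition crowded_ball :: "nat \<Rightarrow> nat \<Rightarrow> real \<Rightarrow> 'w set" where
  "crowded_ball n m s = {\<omega>\<in>space M. \<exists>a\<in>{1..n}. \<exists>S. S \<subseteq> {1..n} - {a} \<and> card S = m \<and>
     (\<forall>b\<in>S. infnorm (X b \<omega> - X a \<omega>) \<le> s)}"

lemma prob_crowded_ball_le:
  assumes s: "0 \<le> s"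
  shows "crowded_ball n m s \<in> events"
    and "prob (crowded_ball n m s) \<le> real n * real (n choose m) * (F * (2 * s) ^ CARD('d)) ^ m"
proof -
  define c where "c = F * (2 * s) ^ CARD('d)"
  have c0: "0 \<le> c" using F s by (simp add: c_def)
  let ?E = "\<lambda>(a, S). {\<omega>\<in>space M. \<forall>b\<in>S. infnorm (X b \<omega> - X a \<omega>) \<le> s}"
  define I where "I = (SIGMA a:{1..n}. {S. S \<subseteq> {1..n} - {a} \<and> card S = m})"
  have fin: "finite I" unfolding I_def by (intro finite_SigmaI) auto
  have eq: "crowded_ball n m s = (\<Union>i\<in>I. ?E i)"
    by (auto simp: crowded_ball_def I_def)
  have ev: "?E i \<in> events \<and> prob (?E i) \<le> c ^ m" if "i \<in> I" for i
  proof -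
    obtain a S where aS: "i = (a, S)" by (cases i)
    with that have i: "i = (a, S)" "a \<in> {1..n}" "S \<subseteq> {1..n} - {a}" "card S = m"
      by (auto simp: I_def)
    then have "finite S" "S \<subseteq> {1..}" "1 \<le> a" "a \<notin> S" by (auto intro: finite_subset)
    from prob_cluster_le[OF this s] i show ?thesis by (simp add: c_def)
  qed
  show "crowded_ball n m s \<in> events"
    unfolding eq using fin ev by (intro sets.finite_UN) auto
  have "card I = (\<Sum>a\<in>{1..n}. card {S. S \<subseteq> {1..n} - {a} \<and> card S = m})"
    unfolding I_def by (rule card_SigmaI) auto
  also have "\<dots> \<le> (\<Sum>a\<in>{1..n}. n choose m)"
  proof (rule sum_mono)
    fix a
    have "card {S. S \<subseteq> {1..n} - {a} \<and> card S = m} \<le> card {S. S \<subseteq> {1..n} \<and> card S = m}"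
      by (intro card_mono) auto
    also have "\<dots> = n choose m" using n_subsets[of "{1..n}" m] by simp
    finally show "card {S. S \<subseteq> {1..n} - {a} \<and> card S = m} \<le> n choose m" .
  qed
  finally have card: "real (card I) \<le> real n * real (n choose m)"
    by (simp flip: of_nat_mult)
  have "prob (crowded_ball n m s) \<le> (\<Sum>i\<in>I. prob (?E i))"
    unfolding eq using fin ev by (intro finite_measure_subadditive_finite) auto
  also have "\<dots> \<le> real (card I) * c ^ m"
    using ev by (intro sum_bounded_above) auto
  also have "\<dots> \<le> real n * real (n choose m) * c ^ m"
    using card c0 by (intro mult_right_mono) auto
  finally show "prob (crowded_ball n m s)
      \<le> real n * real (n choose m) * (F * (2 * s) ^ CARD('d)) ^ m" by (simp add: c_def)
qed

text \<open>
  Vertices are points and not indices, so a clique may only be counted by its indices once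
  coincidences are excluded. They form the case of radius \<open>0\<close> of the cluster estimate.
\<close>

lemma AE_distinct_points: "AE \<omega> in M. \<forall>a\<ge>1. \<forall>b\<ge>1. a \<noteq> b \<longrightarrow> X a \<omega> \<noteq> X b \<omega>"
proof -
  have "AE \<omega> in M. X a \<omega> \<noteq> X b \<omega>" if ab: "1 \<le> a" "1 \<le> b" "a \<noteq> b" for a b
  proof -
    have E: "{\<omega>\<in>space M. infnorm (X b \<omega> - X a \<omega>) \<le> 0} \<in> events"
      and "prob {\<omega>\<in>space M. infnorm (X b \<omega> - X a \<omega>) \<le> 0} \<le> 0"
      using prob_cluster_le[of "{b}" a 0] ab by (auto simp: power_0_left)
    then have "emeasure M {\<omega>\<in>space M. infnorm (X b \<omega> - X a \<omega>) \<le> 0} = 0"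
      by (simp add: emeasure_eq_measure measure_le_0_iff)
    with E show ?thesis
      by (intro AE_I[where N = "{\<omega>\<in>space M. infnorm (X b \<omega> - X a \<omega>) \<le> 0}"])
         (auto simp: infnorm_0)
  qed
  then have "AE \<omega> in M. 1 \<le> a \<longrightarrow> 1 \<le> b \<longrightarrow> a \<noteq> b \<longrightarrow> X a \<omega> \<noteq> X b \<omega>" for a b
    by (cases "1 \<le> a \<and> 1 \<le> b \<and> a \<noteq> b") auto
  then show ?thesis
    by (simp add: AE_all_countable)
qed

lemma mass_grid_cell_le:
  assumes "0 < \<rho>"
  shows "measure P (grid_cell \<rho> k) \<le> F * \<rho> ^ CARD('d)"
proof -
  define x :: "real ^ 'd" where "x = (\<chi> i. \<rho> * (of_int (k i) + 1 / 2))"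
  have "grid_cell \<rho> k \<subseteq> {y. infnorm (y - x) \<le> \<rho> / 2}"
  proof safe
    fix y assume y: "y \<in> grid_cell \<rho> k"
    have "\<bar>(y - x) $ i\<bar> \<le> \<rho> / 2" for i
    proof -
      have "\<lfloor>y $ i / \<rho>\<rfloor> = k i" using y by (simp add: grid_cell_def)
      then have "of_int (k i) \<le> y $ i / \<rho>" "y $ i / \<rho> < of_int (k i) + 1" by linarith+
      then have "of_int (k i) * \<rho> \<le> y $ i" "y $ i < of_int (k i) * \<rho> + \<rho>"
        using assms by (simp_all add: field_simps)
      moreover have "(y - x) $ i = y $ i - of_int (k i) * \<rho> - \<rho> / 2"
        by (simp add: x_def algebra_simps)
      ultimately show ?thesis by linarith
    qed
    then show "infnorm (y - x) \<le> \<rho> / 2" unfolding infnorm_le_iff_cart by blast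
  qed
  then have "measure P (grid_cell \<rho> k) \<le> measure P {y. infnorm (y - x) \<le> \<rho> / 2}"
    by (intro P.finite_measure_mono) (auto simp: sets_P)
  also have "\<dots> \<le> F * \<rho> ^ CARD('d)"
    using mass_ball_le[of "\<rho> / 2" x] assms by simp
  finally show ?thesis .
qed

text \<open>
  Pigeonhole: about \<open>\<rho>^(- d)\<close> cells cover a box that carries half of the mass. The cells lighter
  than \<open>c2 \<rho>^d\<close> carry at most a quarter of it in total, and each of the other cells carries at most
  \<open>F \<rho>^d\<close>, so at least \<open>c1 \<rho>^(- d)\<close> heavy cells are needed for the remaining quarter.
\<close>

lemma ex_heavy_cells:
  shows "\<exists>c1 c2. 0 < c1 \<and> 0 < c2 \<and> (\<forall>\<rho>. 0 < \<rho> \<and> \<rho> \<le> 1 \<longrightarrow>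
    (\<exists>T. finite T \<and> c1 \<le> real (card T) * \<rho> ^ CARD('d) \<and>
      (\<forall>k\<in>T. c2 * \<rho> ^ CARD('d) \<le> measure P (grid_cell \<rho> k))))"
proof -
  obtain R :: nat where R: "1 / 2 < measure P {x. infnorm x \<le> real R}"
  proof -
    have "(\<lambda>R. measure P {x. infnorm x \<le> real R}) \<longlonglongrightarrow> measure P (\<Union>R. {x. infnorm x \<le> real R})"
      by (intro P.finite_Lim_measure_incseq) (auto simp: sets_P incseq_def intro: order_trans)
    also have "(\<Union>R. {x :: real ^ 'd. infnorm x \<le> real R}) = space P"
      by (auto intro: real_arch_simple)
    finally have "\<forall>\<^sub>F R in sequentially. 1 / 2 < measure P {x. infnorm x \<le> real R}"
      by (rule order_tendstoD) (use P.prob_space in simp)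
    then show ?thesis using that by (auto simp: eventually_sequentially)
  qed
  define A where "A = 2 * real R + 3"
  have A: "0 < A" by (simp add: A_def)
  define c1 where "c1 = 1 / (4 * F)"
  define c2 where "c2 = 1 / (4 * A ^ CARD('d))"
  have "\<exists>T. finite T \<and> c1 \<le> real (card T) * \<rho> ^ CARD('d) \<and>
      (\<forall>k\<in>T. c2 * \<rho> ^ CARD('d) \<le> measure P (grid_cell \<rho> k))"
    if \<rho>: "0 < \<rho>" "\<rho> \<le> 1" for \<rho>
  proof -
    define L where "L = \<lceil>real R / \<rho>\<rceil>"
    have "0 \<le> real R / \<rho>" using \<rho> by simp
    then have L0: "0 \<le> L" unfolding L_def by linarith
    define H :: "('d \<Rightarrow> int) set" where "H = PiE UNIV (\<lambda>_. {- L..L})"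
    have finH: "finite H" unfolding H_def by (intro finite_PiE) auto
    have "real (card H) = (2 * of_int L + 1) ^ CARD('d)"
      using L0 by (simp add: H_def card_PiE)
    also have "\<dots> \<le> (A / \<rho>) ^ CARD('d)"
    proof (rule power_mono)
      have "of_int L \<le> real R / \<rho> + 1" unfolding L_def by linarith
      then have "2 * of_int L + 1 \<le> 2 * (real R / \<rho>) + 3" by simp
      also have "\<dots> \<le> A / \<rho>" using \<rho> by (simp add: A_def field_simps)
      finally show "2 * of_int L + 1 \<le> A / \<rho>" .
    qed (use L0 in auto)
    finally have cardH: "real (card H) * (c2 * \<rho> ^ CARD('d)) \<le> 1 / 4"
      using A \<rho> by (simp add: c2_def power_divide field_simps)
    have cover: "{x. infnorm x \<le> real R} \<subseteq> (\<Union>k\<in>H. grid_cell \<rho> k)"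
    proof
      fix x :: "real ^ 'd" assume "x \<in> {x. infnorm x \<le> real R}"
      then have x: "\<bar>x $ i\<bar> \<le> real R" for i by (simp add: infnorm_le_iff_cart)
      have "\<lfloor>x $ i / \<rho>\<rfloor> \<in> {- L..L}" for i
      proof -
        have "\<bar>x $ i / \<rho>\<bar> \<le> real R / \<rho>"
          using x[of i] \<rho> by (simp add: abs_divide divide_right_mono)
        then show ?thesis
          unfolding L_def atLeastAtMost_iff by (intro conjI; linarith)
      qed
      then have "(\<lambda>i. \<lfloor>x $ i / \<rho>\<rfloor>) \<in> H" by (auto simp: H_def PiE_iff)
      moreover have "x \<in> grid_cell \<rho> (\<lambda>i. \<lfloor>x $ i / \<rho>\<rfloor>)" by (simp add: grid_cell_def)
      ultimately show "x \<in> (\<Union>k\<in>H. grid_cell \<rho> k)" by blast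
    qed
    define T where "T = {k\<in>H. c2 * \<rho> ^ CARD('d) \<le> measure P (grid_cell \<rho> k)}"
    have finT: "finite T" using finH by (simp add: T_def)
    have "1 / 2 \<le> measure P (\<Union>k\<in>H. grid_cell \<rho> k)"
      using R P.finite_measure_mono[OF cover] finH by (auto simp: sets_P)
    also have "\<dots> \<le> (\<Sum>k\<in>H. measure P (grid_cell \<rho> k))"
      using finH by (intro P.finite_measure_subadditive_finite) (auto simp: sets_P)
    also have "\<dots> = (\<Sum>k\<in>T. measure P (grid_cell \<rho> k)) + (\<Sum>k\<in>H - T. measure P (grid_cell \<rho> k))"
      using finH by (subst sum.subset_diff[of T H]) (auto simp: T_def)
    also have "\<dots> \<le> real (card T) * (F * \<rho> ^ CARD('d)) + real (card (H - T)) * (c2 * \<rho> ^ CARD('d))"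
      by (intro add_mono sum_bounded_above mass_grid_cell_le \<rho>) (auto simp: T_def)
    also have "real (card (H - T)) * (c2 * \<rho> ^ CARD('d)) \<le> real (card H) * (c2 * \<rho> ^ CARD('d))"
      using finH A \<rho> by (intro mult_right_mono) (auto simp: c2_def intro: card_mono)
    finally have "1 / 4 \<le> real (card T) * (F * \<rho> ^ CARD('d))" using cardH by simp
    then have "c1 \<le> real (card T) * \<rho> ^ CARD('d)"
      using F by (simp add: c1_def field_simps)
    with finT show ?thesis by (intro exI[of _ T]) (auto simp: T_def)
  qed
  moreover have "0 < c1" "0 < c2" using F A by (simp_all add: c1_def c2_def)
  ultimately show ?thesis by blast
qed

end

section \<open>Deviation estimates in the sparse regime\<close>

text \<open>
  These two facts make multiplicative constants irrelevant: for large \<open>t\<close> the constants \<open>C\<close> and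
  \<open>c\<close> are absorbed into an arbitrarily small power of \<open>t\<close>.
\<close>

lemma eventually_ln_le_powr:
  fixes \<delta> C :: real
  assumes "0 < \<delta>" "0 < C"
  shows "\<forall>\<^sub>F t in at_top. C * ln t \<le> t powr \<delta>"
  using assms by real_asymp

lemma eventually_linear_le_powr:
  fixes \<gamma> c :: real
  assumes "1 < \<gamma>" "0 < c"
  shows "\<forall>\<^sub>F t in at_top. c * t \<le> t powr \<gamma>"
  using assms by real_asymp

lemma power_self_over_fact_le_exp: "real m ^ m / fact m \<le> exp (real m)"
proof -
  have "(\<Sum>k\<in>{m}. real m ^ k /\<^sub>R fact k) \<le> (\<Sum>k. real m ^ k /\<^sub>R fact k)"
    by (intro sum_le_suminf summable_exp_generic) auto
  then show ?thesis by (simp add: exp_def divide_inverse mult.commute)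
qed

lemma binomial_le_exp_power:
  assumes "0 < m"
  shows "real (n choose m) \<le> (exp 1 * real n / real m) ^ m"
proof -
  have "real (n choose m) * fact m \<le> real n ^ m"
    using binomial_fact_pow[of n m] by (metis of_nat_fact of_nat_le_iff of_nat_mult of_nat_power)
  then have "real (n choose m) \<le> real n ^ m / fact m"
    by (simp add: field_simps)
  also have "\<dots> = (real n / real m) ^ m * (real m ^ m / fact m)"
    using assms by (simp add: power_divide)
  also have "\<dots> \<le> (real n / real m) ^ m * exp (real m)"
    by (intro mult_left_mono power_self_over_fact_le_exp) auto
  also have "exp (real m) = exp 1 ^ m"
    by (simp add: exp_of_nat_mult[symmetric])
  also have "(real n / real m) ^ m * exp 1 ^ m = (exp 1 * real n / real m) ^ m"
    by (simp add: power_mult_distrib[symmetric] mult.commute)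
  finally show ?thesis .
qed

lemma half_le_one_minus_exp:
  fixes y :: real
  assumes "0 \<le> y" "y \<le> 1"
  shows "y / 2 \<le> 1 - exp (- y)"
proof -
  have "exp (- y) \<le> 1 / (1 + y)"
    using assms exp_ge_add_one_self[of y] by (simp add: exp_minus field_simps)
  also have "\<dots> \<le> 1 - y / 2"
  proof -
    have "y * y \<le> y * 1" using assms by (intro mult_left_mono) auto
    then show ?thesis using assms by (simp add: field_simps)
  qed
  finally show ?thesis by simp
qed

text \<open>
  The identity \<open>t powr k = N\<close> for \<open>k = ln N / ln t\<close>, which is the reason why \<open>k\<close> is the critical
  occupancy.
\<close>

lemma powr_ln_ratio:
  fixes N t :: real
  assumes "0 < N" "1 < t"
  shows "t powr (ln N / ln t * b) = N powr b"
  using assms by (simp add: powr_def)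

text \<open>
  For \<open>m\<close> slightly above \<open>k\<close> the expected number of clusters is small: \<open>\<Lambda> / m \<le> \<Lambda> / k = ln t / t\<close>, so
  the base is at most \<open>t\<close> to a power close to \<open>- 1\<close>, and \<open>t powr k = N\<close>.
\<close>

lemma crowded_power_bound:
  fixes N \<Lambda> t k C \<epsilon> :: real
  assumes N: "1 < N" and \<Lambda>: "0 < \<Lambda>" and t: "t = ln N / \<Lambda>" "1 < t" and k: "k = ln N / ln t"
    and \<epsilon>: "0 < \<epsilon>" and m: "(1 + \<epsilon>) * k \<le> real m" and C: "0 \<le> C"
    and le: "C * ln t / t \<le> t powr (- ((1 + \<epsilon> / 2) / (1 + \<epsilon>)))"
  shows "(C * \<Lambda> / real m) ^ m \<le> N powr (- (1 + \<epsilon> / 2))"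
proof -
  have k0: "0 < k" using N t k by simp
  have "1 * k \<le> (1 + \<epsilon>) * k" using k0 \<epsilon> by (intro mult_right_mono) auto
  then have km: "k \<le> real m" using m by simp
  have "C * \<Lambda> / real m \<le> C * \<Lambda> / k"
    using k0 km C \<Lambda> by (intro divide_left_mono) auto
  also have "\<dots> = C * ln t / t"
    using N t \<Lambda> k by simp
  finally have "C * \<Lambda> / real m \<le> t powr (- ((1 + \<epsilon> / 2) / (1 + \<epsilon>)))" using le by simp
  then have "(C * \<Lambda> / real m) ^ m \<le> (t powr (- ((1 + \<epsilon> / 2) / (1 + \<epsilon>)))) ^ m"
    using C \<Lambda> by (intro power_mono) auto
  also have "\<dots> = t powr (- ((1 + \<epsilon> / 2) / (1 + \<epsilon>)) * real m)"
    using t(2) by (subst powr_power) (auto simp: mult.commute)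
  also have "\<dots> \<le> t powr (- ((1 + \<epsilon> / 2) / (1 + \<epsilon>)) * ((1 + \<epsilon>) * k))"
  proof (rule powr_mono)
    have "((1 + \<epsilon> / 2) / (1 + \<epsilon>)) * ((1 + \<epsilon>) * k) \<le> ((1 + \<epsilon> / 2) / (1 + \<epsilon>)) * real m"
      using m \<epsilon> by (intro mult_left_mono) auto
    then show "- ((1 + \<epsilon> / 2) / (1 + \<epsilon>)) * real m \<le> - ((1 + \<epsilon> / 2) / (1 + \<epsilon>)) * ((1 + \<epsilon>) * k)"
      by simp
  qed (use t in auto)
  also have "- ((1 + \<epsilon> / 2) / (1 + \<epsilon>)) * ((1 + \<epsilon>) * k)
      = - (((1 + \<epsilon> / 2) / (1 + \<epsilon>)) * (1 + \<epsilon>)) * k"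
    by (simp only: mult.assoc mult_minus_left)
  also have "((1 + \<epsilon> / 2) / (1 + \<epsilon>)) * (1 + \<epsilon>) = 1 + \<epsilon> / 2"
    using \<epsilon> by simp
  also have "- (1 + \<epsilon> / 2) * k = k * (- (1 + \<epsilon> / 2))"
    by (rule mult.commute)
  also have "t powr \<dots> = N powr (- (1 + \<epsilon> / 2))"
    unfolding k using N t by (intro powr_ln_ratio) auto
  finally show ?thesis .
qed

text \<open>
  The counterpart for \<open>m\<close> slightly below \<open>k\<close>, where \<open>1 / (c t)\<close> will be a lower bound for the
  probability that one group hits a given heavy cell.
\<close>

lemma sparse_power_bound:
  fixes N t k c \<epsilon> :: real
  assumes N: "1 < N" and t: "1 < t" and k: "k = ln N / ln t"
    and \<epsilon>: "0 < \<epsilon>" "\<epsilon> < 1" and m: "real m \<le> (1 - \<epsilon>) * k" and c: "0 \<le> c"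
    and le: "c * t \<le> t powr ((1 - \<epsilon> / 2) / (1 - \<epsilon>))"
  shows "(c * t) ^ m \<le> N powr (1 - \<epsilon> / 2)"
proof -
  have "(c * t) ^ m \<le> (t powr ((1 - \<epsilon> / 2) / (1 - \<epsilon>))) ^ m"
    using c t le by (intro power_mono) auto
  also have "\<dots> = t powr ((1 - \<epsilon> / 2) / (1 - \<epsilon>) * real m)"
    using t by (subst powr_power) (auto simp: mult.commute)
  also have "\<dots> \<le> t powr ((1 - \<epsilon> / 2) / (1 - \<epsilon>) * ((1 - \<epsilon>) * k))"
    using t m \<epsilon> by (intro powr_mono mult_left_mono) auto
  also have "(1 - \<epsilon> / 2) / (1 - \<epsilon>) * ((1 - \<epsilon>) * k) = k * (1 - \<epsilon> / 2)"
    using \<epsilon> by simp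
  also have "t powr \<dots> = N powr (1 - \<epsilon> / 2)"
    unfolding k using N t by (intro powr_ln_ratio) auto
  finally show ?thesis .
qed

text \<open>
  The dyadic cell of the pairs \<open>(n, r)\<close> with \<open>n\<close> of order \<open>2^j\<close> and \<open>r\<close> of order \<open>2^(- i)\<close> is
  represented by its corner \<open>(2^j, 2^(- i))\<close>. With \<open>N = 2^j\<close> and \<open>\<Lambda> = N 2^(- i d)\<close>, which is of the
  order of \<open>n r^d\<close>, the condition is a quantitative form of
  \<open>N powr (- \<epsilon>) \<lless> \<Lambda> \<lless> ln N\<close>.
\<close>

definition sparse_cell :: "nat \<Rightarrow> real \<Rightarrow> nat \<Rightarrow> nat \<Rightarrow> bool" where
  "sparse_cell d \<eta> j i \<longleftrightarrow>
     (2 ^ j) powr (- \<eta>) \<le> (2 ^ j / (2 ^ i) ^ d :: real) \<and> (2 ^ j / (2 ^ i) ^ d :: real) \<le> \<eta> * ln (2 ^ j)"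

context iid_bounded_sample
begin

text \<open>
  The outcome \<open>\<omega>\<close> is as expected throughout a dyadic cell: no ball around a sample point, at the
  scale relevant for \<open>\<chi>\<^sub>l\<close>, contains more than \<open>m\<close> points, even for the largest
  \<open>n\<close> and \<open>r\<close> of the cell, some set at the scale relevant for \<open>\<chi>\<close> contains \<open>m'\<close> points already for
  the smallest ones, and \<open>m / m'\<close> is close to \<open>1\<close>.
\<close>

definition focused :: "nat \<Rightarrow> real \<Rightarrow> nat \<Rightarrow> nat \<Rightarrow> 'w \<Rightarrow> bool" where
  "focused l \<epsilon> j i \<omega> \<longleftrightarrow> (\<exists>m m'. 0 < m' \<and> real m \<le> (1 + 2 * \<epsilon>) / (1 - 2 * \<epsilon>) * real m' \<and>
     (\<forall>a\<in>{1..2 * 2 ^ j}. card {b\<in>{1..2 * 2 ^ j} - {a}. infnorm (X b \<omega> - X a \<omega>) \<le> real l / 2 ^ i} < m) \<and>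
     (\<exists>K\<subseteq>{1..2 ^ j}. card K = m' \<and>
        (\<forall>a\<in>K. \<forall>b\<in>K. infnorm (X a \<omega> - X b \<omega>) < 1 / (2 * real CARD('d) * 2 ^ i))))"

lemma not_crowdedD:
  assumes "\<omega> \<in> space M - crowded_ball n m s" "a \<in> {1..n}"
  shows "card {b\<in>{1..n} - {a}. infnorm (X b \<omega> - X a \<omega>) \<le> s} < m"
proof (rule ccontr)
  let ?A = "{b\<in>{1..n} - {a}. infnorm (X b \<omega> - X a \<omega>) \<le> s}"
  assume "\<not> card ?A < m"
  then obtain S where "S \<subseteq> ?A" "card S = m"
    by (meson not_less obtain_subset_with_card_n)
  then have "\<omega> \<in> crowded_ball n m s"
    using assms unfolding crowded_ball_def by blast
  then show False using assms by simp
qed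

text \<open>
  The first \<open>N\<close> points are cut into \<open>m\<close> consecutive groups of \<open>N div m\<close> points; one point from each
  group in a common cell gives the set \<open>K\<close>.
\<close>

lemma prob_no_clique_le:
  fixes T :: "('d \<Rightarrow> int) set"
  assumes T: "finite T" "T \<noteq> {}" and \<rho>: "0 < \<rho>" and q: "0 < q" "\<And>k. k \<in> T \<Longrightarrow> q \<le> measure P (grid_cell \<rho> k)"
    and m: "1 \<le> m" "m \<le> N"
  shows "\<exists>B\<in>events. prob B \<le> 1 / (real (card T) * (1 - (1 - q) ^ (N div m)) ^ m) \<and>
    (\<forall>\<omega>\<in>space M - B. \<exists>K\<subseteq>{1..N}. card K = m \<and> (\<forall>a\<in>K. \<forall>b\<in>K. infnorm (X a \<omega> - X b \<omega>) < \<rho>))"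
proof -
  define g where "g = N div m"
  have g: "0 < g" using m by (simp add: g_def div_greater_zero_iff)
  define J where "J j = {j * g + 1..j * g + g}" for j
  have Jdisj: "J j \<inter> J j' = {}" if "j < j'" for j j'
  proof -
    have "(j + 1) * g \<le> j' * g" using that by (intro mult_right_mono) auto
    then show ?thesis by (auto simp: J_def)
  qed
  then have Jdisj': "J j \<inter> J j' = {}" if "j \<noteq> j'" for j j'
    using that by (cases j j' rule: linorder_cases) blast+
  have JN: "J j \<subseteq> {1..N}" if "j < m" for j
  proof -
    have "(j + 1) * g \<le> m * g" using that by (intro mult_right_mono) auto
    also have "\<dots> \<le> N" by (simp add: g_def)
    finally show ?thesis by (auto simp: J_def)
  qed
  let ?B = "{\<omega>\<in>space M. \<forall>k\<in>T. \<exists>j\<in>{..<m}. \<forall>a\<in>J j. X a \<omega> \<notin> grid_cell \<rho> k}"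
  have dJ: "disjoint_family_on J {..<m}"
    using Jdisj' by (auto simp: disjoint_family_on_def)
  have cJ: "card (J j) = g" for j by (simp add: J_def)
  have fJ: "finite (J j) \<and> J j \<subseteq> {1..}" for j by (auto simp: J_def)
  note * = prob_no_crowded_cell_le[where Q = "grid_cell \<rho>" and L = "{..<m}" and J = J and T = T and q = q and g = g,
      OF T grid_cell_borel disjoint_grid_cells q(2,1) _ fJ dJ cJ g]
  show ?thesis
  proof (intro bexI[of _ ?B] conjI ballI)
    show "?B \<in> events" using *(1) by simp
    show "prob ?B \<le> 1 / (real (card T) * (1 - (1 - q) ^ (N div m)) ^ m)"
      using *(2) by (simp add: g_def)
    fix \<omega> assume "\<omega> \<in> space M - ?B"
    then obtain k where "k \<in> T" "\<forall>j\<in>{..<m}. \<exists>a\<in>J j. X a \<omega> \<in> grid_cell \<rho> k" by auto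
    then obtain h where h: "\<And>j. j < m \<Longrightarrow> h j \<in> J j \<and> X (h j) \<omega> \<in> grid_cell \<rho> k"
      by (metis lessThan_iff)
    have "inj_on h {..<m}"
      using h Jdisj' by (intro inj_onI) (metis disjoint_iff lessThan_iff)
    then have "card (h ` {..<m}) = m" by (simp add: card_image)
    moreover have "h ` {..<m} \<subseteq> {1..N}" using h JN by blast
    moreover have "\<forall>a\<in>h ` {..<m}. \<forall>b\<in>h ` {..<m}. infnorm (X a \<omega> - X b \<omega>) < \<rho>"
      using h infnorm_less_in_grid_cell[OF \<rho>] by blast
    ultimately show "\<exists>K\<subseteq>{1..N}. card K = m \<and> (\<forall>a\<in>K. \<forall>b\<in>K. infnorm (X a \<omega> - X b \<omega>) < \<rho>)"
      by blast
  qed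
qed

end

section \<open>Concentration along dyadic cells\<close>

context iid_bounded_sample
begin

text \<open>
  The first and the second moment bound, evaluated at \<open>m = (1 + \<epsilon>) k\<close> and \<open>m' = (1 - \<epsilon>) k\<close>. The
  constants depend on \<open>\<epsilon>\<close>, \<open>l\<close> and the distribution, but not on \<open>i\<close>; this uniformity is what
  allows a union bound over all \<open>i\<close> belonging to the same \<open>j\<close>.
\<close>

lemma prob_unfocused_le:
  assumes l: "1 \<le> l" and \<epsilon>: "0 < \<epsilon>" "\<epsilon> < 1 / 2"
  shows "\<exists>\<eta> C J. 0 < \<eta> \<and> \<eta> \<le> 1 \<and> 0 \<le> C \<and> (\<forall>j\<ge>J. \<forall>i. sparse_cell CARD('d) \<eta> j i \<longrightarrow>
    (\<exists>B\<in>events. prob B \<le> C * (1 + ln (2 ^ j)) * (2 ^ j) powr (- (\<epsilon> / 2)) \<and>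
      (\<forall>\<omega>\<in>space M - B. focused l \<epsilon> j i \<omega>)))"
proof -
  define d where "d = CARD('d)"
  have d: "1 \<le> real d" by (simp add: d_def Suc_le_eq)
  obtain c1 c2 where c: "0 < c1" "0 < c2" and heavy: "\<And>\<rho>. 0 < \<rho> \<Longrightarrow> \<rho> \<le> 1 \<Longrightarrow>
    \<exists>T. finite T \<and> c1 \<le> real (card T) * \<rho> ^ d \<and>
      (\<forall>k\<in>T. c2 * \<rho> ^ d \<le> measure P (grid_cell \<rho> k))"
    using ex_heavy_cells unfolding d_def by blast
  \<comment> \<open>The expected number of clusters of \<open>m\<close> points around a given point is at most \<open>(C \<Lambda> / m)^m\<close>;\<close>
  \<comment> \<open>there are at least \<open>b1 N / \<Lambda>\<close> heavy cells, each of mass at least \<open>b2 \<Lambda> / N\<close>.\<close>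
  define C where "C = 2 * exp 1 * (F * (2 * real l) ^ d)"
  define b1 where "b1 = c1 * (2 * real d) ^ d"
  define b2 where "b2 = c2 / (2 * real d) ^ d"
  define c where "c = 4 / b2"
  have pos: "0 < C" "0 < b1" "0 < b2" "0 < c"
    using F l c d by (simp_all add: C_def b1_def b2_def c_def)
  define \<beta> where "\<beta> = (1 + \<epsilon> / 2) / (1 + \<epsilon>)"
  define \<gamma> where "\<gamma> = (1 - \<epsilon> / 2) / (1 - \<epsilon>)"
  have \<beta>: "\<beta> < 1" and \<gamma>: "1 < \<gamma>" using \<epsilon> by (simp_all add: \<beta>_def \<gamma>_def)
  have "\<forall>\<^sub>F t in at_top. C * ln t \<le> t powr (1 - \<beta>) \<and> c * t \<le> t powr \<gamma> \<and> exp 1 \<le> t \<and> b2 \<le> t"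
    using \<beta> \<gamma> pos by (intro eventually_conj eventually_ln_le_powr eventually_linear_le_powr
      eventually_ge_at_top) auto
  then obtain t0 where t0: "\<And>t. t0 \<le> t \<Longrightarrow>
      C * ln t \<le> t powr (1 - \<beta>) \<and> c * t \<le> t powr \<gamma> \<and> exp 1 \<le> t \<and> b2 \<le> t"
    by (auto simp: eventually_at_top_linorder)
  \<comment> \<open>\<open>\<eta> \<le> 1 / t0\<close> forces \<open>t \<ge> t0\<close>, and \<open>\<eta> \<le> \<epsilon> / 2\<close> forces \<open>\<epsilon> k \<ge> 1\<close> for large \<open>j\<close>, so that rounding\<close>
  \<comment> \<open>\<open>m\<close> and \<open>m'\<close> to integers costs at most another \<open>\<epsilon> k\<close>. The bound \<open>\<eta> \<le> 1\<close> limits \<open>i\<close> to at most \<open>2 j\<close>.\<close>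
  define \<eta> where "\<eta> = Min {1, 1 / max t0 1, \<epsilon> / 2}"
  have \<eta>: "0 < \<eta>" "\<eta> \<le> 1" "\<eta> \<le> 1 / max t0 1" "\<eta> \<le> \<epsilon> / 2"
    using \<epsilon> unfolding \<eta>_def by auto
  have "\<forall>\<^sub>F j::nat in sequentially. ln (ln (2 ^ j)) \<le> \<eta> * ln (2 ^ j) \<and> 1 \<le> j"
    using \<eta>(1) by (intro eventually_conj eventually_ge_at_top) real_asymp
  then obtain J where J: "\<And>j. J \<le> j \<Longrightarrow> ln (ln (2 ^ j)) \<le> \<eta> * ln (2 ^ j :: real) \<and> 1 \<le> j"
    by (auto simp: eventually_sequentially)
  define D where "D = 2 + 1 / b1"
  have "\<exists>B\<in>events. prob B \<le> D * (1 + ln (2 ^ j)) * (2 ^ j) powr (- (\<epsilon> / 2)) \<and>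
      (\<forall>\<omega>\<in>space M - B. focused l \<epsilon> j i \<omega>)"
    if j: "J \<le> j" and cell: "sparse_cell d \<eta> j i" for i j
  proof -
    define N where "N = (2 :: real) ^ j"
    define \<Lambda> where "\<Lambda> = N / (2 ^ i) ^ d"
    have "2 \<le> N" using J[OF j] power_increasing[of 1 j "2::real"] by (simp add: N_def)
    then have N: "1 < N" by simp
    then have lnN: "0 < ln N" by simp
    have \<Lambda>0: "0 < \<Lambda>" using N by (simp add: \<Lambda>_def)
    have \<Lambda>: "N powr (- \<eta>) \<le> \<Lambda>" "\<Lambda> \<le> \<eta> * ln N"
      using cell by (simp_all add: sparse_cell_def N_def \<Lambda>_def)
    define t where "t = ln N / \<Lambda>"
    have "1 / \<eta> \<le> t"
      using \<Lambda>(2) \<Lambda>0 \<eta>(1) by (simp add: t_def field_simps)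
    moreover have "max t0 1 \<le> 1 / \<eta>"
    proof -
      have "\<eta> * max t0 1 \<le> 1" using \<eta>(3) by (subst (asm) pos_le_divide_eq) auto
      then show ?thesis
        using \<eta>(1) by (subst pos_le_divide_eq) (simp_all only: mult.commute)
    qed
    ultimately have "t0 \<le> t" by simp
    then have tC: "C * ln t \<le> t powr (1 - \<beta>)" and tc: "c * t \<le> t powr \<gamma>"
      and te: "exp 1 \<le> t" and tb: "b2 \<le> t"
      using t0 by blast+
    have t1: "1 < t" using te exp_gt_one[of "1::real"] by linarith
    have lnt: "1 \<le> ln t" using te t1 by (subst ln_ge_iff) auto
    have tC': "C * ln t / t \<le> t powr (- \<beta>)"
      using tC t1 by (simp add: powr_diff powr_minus field_simps)
    define k where "k = ln N / ln t"
    have k0: "0 < k" using lnN lnt by (simp add: k_def)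
    have kN: "k \<le> ln N" using lnN lnt by (simp add: k_def divide_le_eq)
    have k\<epsilon>: "1 \<le> \<epsilon> * k"
    proof -
      have "- \<eta> * ln N \<le> ln \<Lambda>"
        using \<Lambda>(1) N \<Lambda>0 by (metis ln_le_cancel_iff ln_powr less_trans powr_gt_zero zero_less_one less_irrefl)
      moreover have "ln t = ln (ln N) - ln \<Lambda>"
        using lnN \<Lambda>0 by (simp add: t_def ln_div)
      moreover have "ln (ln N) \<le> \<eta> * ln N" using J[OF j] by (simp add: N_def)
      ultimately have "ln t \<le> 2 * \<eta> * ln N" by simp
      also have "\<dots> \<le> \<epsilon> * ln N"
        using \<eta>(4) lnN by (intro mult_right_mono) auto
      finally show ?thesis using lnt by (simp add: k_def field_simps)
    qed
    have "ln N \<le> N - 1" using N by (intro ln_le_minus_one) auto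

    define m where "m = nat \<lceil>(1 + \<epsilon>) * k\<rceil>"
    have m: "(1 + \<epsilon>) * k \<le> real m" unfolding m_def by (rule real_nat_ceiling_ge)
    have "0 < (1 + \<epsilon>) * k" using k0 \<epsilon> by simp
    then have "real m \<le> (1 + \<epsilon>) * k + 1" unfolding m_def by linarith
    then have m_le: "real m \<le> (1 + 2 * \<epsilon>) * k"
      using k\<epsilon> by (simp add: algebra_simps)
    have m0: "0 < m" using m \<open>0 < (1 + \<epsilon>) * k\<close> by (cases m) auto

    define m' where "m' = nat \<lfloor>(1 - \<epsilon>) * k\<rfloor>"
    have "0 < (1 - \<epsilon>) * k" using k0 \<epsilon> by simp
    then have m': "real m' \<le> (1 - \<epsilon>) * k" and "(1 - \<epsilon>) * k - 1 \<le> real m'"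
      unfolding m'_def by linarith+
    then have m'_ge: "(1 - 2 * \<epsilon>) * k \<le> real m'"
      using k\<epsilon> by (simp add: algebra_simps)
    have "0 < (1 - 2 * \<epsilon>) * k" using k0 \<epsilon> by simp
    then have m'0: "1 \<le> m'" using m'_ge by (cases m') auto
    have "real m' \<le> 1 * k" using m' k0 \<epsilon> by (intro order_trans[OF m'] mult_right_mono) auto
    then have m'k: "real m' \<le> k" by simp
    have "real m' \<le> N"
      using m'k kN \<open>ln N \<le> N - 1\<close> by linarith
    then have m'N: "m' \<le> 2 ^ j" by (simp add: N_def)
    have ratio: "real m \<le> (1 + 2 * \<epsilon>) / (1 - 2 * \<epsilon>) * real m'"
    proof -
      have "k \<le> real m' / (1 - 2 * \<epsilon>)" using m'_ge \<epsilon> by (simp add: field_simps)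
      then have "(1 + 2 * \<epsilon>) * k \<le> (1 + 2 * \<epsilon>) * (real m' / (1 - 2 * \<epsilon>))"
        using \<epsilon> by (intro mult_left_mono) auto
      with m_le show ?thesis by simp
    qed

    have twoi: "1 \<le> (2 :: real) ^ i" by simp
    let ?s = "real l / 2 ^ i"
    define B1 where "B1 = crowded_ball (2 * 2 ^ j) m ?s"
    have B1: "B1 \<in> events" unfolding B1_def by (rule prob_crowded_ball_le) simp
    have "prob B1 \<le> 2 * N * real (2 * 2 ^ j choose m) * (F * (2 * ?s) ^ d) ^ m"
      unfolding B1_def d_def using prob_crowded_ball_le(2)[of ?s "2 * 2 ^ j" m] by (simp add: N_def)
    also have "\<dots> \<le> 2 * N * (exp 1 * (2 * N) / real m) ^ m * (F * (2 * ?s) ^ d) ^ m"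
      using binomial_le_exp_power[OF m0, of "2 * 2 ^ j"] N F
      by (intro mult_right_mono mult_left_mono) (auto simp: N_def)
    also have "\<dots> = 2 * N * (exp 1 * (2 * N) / real m * (F * (2 * ?s) ^ d)) ^ m"
      by (simp only: mult.assoc power_mult_distrib)
    also have "exp 1 * (2 * N) / real m * (F * (2 * ?s) ^ d) = C * \<Lambda> / real m"
      by (simp add: C_def \<Lambda>_def power_mult_distrib power_divide mult_ac)
    also have "2 * N * (C * \<Lambda> / real m) ^ m \<le> 2 * N * N powr (- (1 + \<epsilon> / 2))"
      using N pos tC' unfolding \<beta>_def
      by (intro mult_left_mono crowded_power_bound[OF N \<Lambda>0 t_def t1 k_def \<epsilon>(1) m]) auto
    also have "\<dots> = 2 * (N powr 1 * N powr (- (1 + \<epsilon> / 2)))"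
      using N by simp
    also have "\<dots> = 2 * N powr (- (\<epsilon> / 2))"
      by (simp only: powr_add[symmetric]) simp
    finally have pB1: "prob B1 \<le> 2 * N powr (- (\<epsilon> / 2))" .

    define \<rho> where "\<rho> = 1 / (2 * real d * 2 ^ i)"
    have "1 * 1 \<le> (2 * real d) * (2 ^ i)" using d twoi by (intro mult_mono) auto
    then have \<rho>: "0 < \<rho>" "\<rho> \<le> 1" using d unfolding \<rho>_def by (auto simp: divide_le_eq)
    have \<rho>d: "\<rho> ^ d = \<Lambda> / N / (2 * real d) ^ d"
      using N by (simp add: \<rho>_def \<Lambda>_def power_mult_distrib power_divide)
    obtain T where T: "finite T" "c1 \<le> real (card T) * \<rho> ^ d"
      "\<And>k. k \<in> T \<Longrightarrow> c2 * \<rho> ^ d \<le> measure P (grid_cell \<rho> k)"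
      using heavy[OF \<rho>] by blast
    have T0: "T \<noteq> {}" using T(2) \<open>0 < c1\<close> by auto
    define q where "q = b2 * \<Lambda> / N"
    have q_eq: "q = c2 * \<rho> ^ d" by (simp add: q_def b2_def \<rho>d)
    have q0: "0 < q" using pos \<Lambda>0 N by (simp add: q_def)
    have q1: "q \<le> 1" using T0 T(3) q_eq P.prob_le_1 by (metis ex_in_conv order_trans)
    have cardT: "b1 * N / \<Lambda> \<le> real (card T)"
      using T(2) N \<Lambda>0 d by (simp add: b1_def \<rho>d field_simps)
    define g where "g = 2 ^ j div m'"
    obtain B2 where B2: "B2 \<in> events"
      "prob B2 \<le> 1 / (real (card T) * (1 - (1 - q) ^ g) ^ m')"
      "\<And>\<omega>. \<omega> \<in> space M - B2 \<Longrightarrow> \<exists>K\<subseteq>{1..2 ^ j}. card K = m' \<and>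
          (\<forall>a\<in>K. \<forall>b\<in>K. infnorm (X a \<omega> - X b \<omega>) < \<rho>)"
      using prob_no_clique_le[OF T(1) T0 \<rho>(1) q0 _ m'0 m'N] T(3) unfolding q_eq g_def by blast
    \<comment> \<open>A group has about \<open>N / m'\<close> points, so it hits a heavy cell with probability of order at least\<close>
    \<comment> \<open>\<open>q N / m' \<ge> b2 \<Lambda> / k = b2 ln t / t\<close>; the factor \<open>ln t \<ge> 1\<close> is given away.\<close>
    have w: "1 / (c * t) \<le> 1 - (1 - q) ^ g"
    proof -
      define y where "y = b2 / (2 * t)"
      have y: "0 \<le> y" "y \<le> 1" using pos t1 tb by (auto simp: y_def divide_le_eq)
      have g: "N / (2 * real m') \<le> real g"
      proof -
        have "1 \<le> g" using m'0 m'N by (simp add: g_def Suc_le_eq div_greater_zero_iff)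
        have "2 ^ j < m' * (g + 1)"
          using dividend_less_times_div[of m' "2 ^ j"] m'0 unfolding g_def by (simp add: algebra_simps)
        also have "\<dots> \<le> m' * (2 * g)" using \<open>1 \<le> g\<close> by (intro mult_left_mono) auto
        finally have "real (2 ^ j) \<le> real (m' * (2 * g))" by (simp only: of_nat_le_iff less_imp_le)
        then show ?thesis using m'0 by (simp add: N_def field_simps)
      qed
      have "y \<le> b2 * ln t / (2 * t)"
        unfolding y_def using pos t1 lnt by (intro divide_right_mono) auto
      also have "\<dots> = b2 * \<Lambda> / (2 * k)"
        using lnN lnt \<Lambda>0 by (simp add: t_def[symmetric] k_def) (simp add: t_def field_simps)
      also have "\<dots> \<le> b2 * \<Lambda> / (2 * real m')"
        using m'k m'0 pos \<Lambda>0 by (intro divide_left_mono) auto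
      also have "\<dots> = q * (N / (2 * real m'))" using N by (simp add: q_def)
      also have "\<dots> \<le> q * real g" using g q0 by (intro mult_left_mono) auto
      finally have yq: "y \<le> q * real g" .
      have "(1 - q) ^ g \<le> exp (- q) ^ g"
        using q1 exp_ge_add_one_self[of "- q"] by (intro power_mono) auto
      also have "\<dots> = exp (- (q * real g))"
        by (simp add: exp_of_nat_mult[symmetric] mult.commute)
      also have "\<dots> \<le> exp (- y)" using yq by simp
      finally have "y / 2 \<le> 1 - (1 - q) ^ g"
        using half_le_one_minus_exp[OF y] by simp
      moreover have "1 / (c * t) = y / 2" using pos by (simp add: c_def y_def)
      ultimately show ?thesis by simp
    qed
    have ct0: "0 < c * t" using pos t1 by simp
    have le: "b1 * N / \<Lambda> * (1 / (c * t)) ^ m' \<le> real (card T) * (1 - (1 - q) ^ g) ^ m'"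
      using cardT w ct0 by (intro mult_mono power_mono) auto
    have gt: "0 < b1 * N / \<Lambda> * (1 / (c * t)) ^ m'" using pos N \<Lambda>0 t1 by simp
    note B2(2)
    also have "1 / (real (card T) * (1 - (1 - q) ^ g) ^ m') \<le> 1 / (b1 * N / \<Lambda> * (1 / (c * t)) ^ m')"
      by (rule divide_left_mono[OF le _ mult_pos_pos[OF less_le_trans[OF gt le] gt]]) simp
    also have "\<dots> = \<Lambda> / (b1 * N) * (c * t) ^ m'"
      by (simp add: power_divide)
    also have "\<dots> \<le> \<Lambda> / (b1 * N) * N powr (1 - \<epsilon> / 2)"
      using N \<epsilon> pos \<Lambda>0 tc unfolding \<gamma>_def
      by (intro mult_left_mono sparse_power_bound[OF N t1 k_def \<epsilon>(1) _ m']) auto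
    also have "\<dots> = \<Lambda> / b1 * N powr (- (\<epsilon> / 2))"
      using N powr_add[of N 1 "- (\<epsilon> / 2)"] by simp
    also have "\<dots> \<le> ln N / b1 * N powr (- (\<epsilon> / 2))"
    proof (intro mult_right_mono divide_right_mono)
      have "\<eta> * ln N \<le> 1 * ln N" using \<eta> lnN by (intro mult_right_mono) auto
      then show "\<Lambda> \<le> ln N" using \<Lambda>(2) by simp
    qed (use pos in auto)
    finally have pB2: "prob B2 \<le> ln N / b1 * N powr (- (\<epsilon> / 2))" .

    show ?thesis
    proof (intro bexI[of _ "B1 \<union> B2"] conjI ballI)
      show "B1 \<union> B2 \<in> events" using B1 B2(1) by blast
      have "prob (B1 \<union> B2) \<le> prob B1 + prob B2"
        using B1 B2(1) by (rule measure_Un_le)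
      also have "\<dots> \<le> (2 + ln N / b1) * N powr (- (\<epsilon> / 2))"
        using pB1 pB2 by (simp add: algebra_simps)
      also have "\<dots> \<le> D * (1 + ln N) * N powr (- (\<epsilon> / 2))"
        using lnN pos by (intro mult_right_mono) (auto simp: D_def field_simps)
      finally show "prob (B1 \<union> B2) \<le> D * (1 + ln (2 ^ j)) * (2 ^ j) powr (- (\<epsilon> / 2))"
        by (simp add: N_def)
      fix \<omega> assume \<omega>: "\<omega> \<in> space M - (B1 \<union> B2)"
      have a: "\<forall>a\<in>{1..2 * 2 ^ j}. card {b\<in>{1..2 * 2 ^ j} - {a}. infnorm (X b \<omega> - X a \<omega>) \<le> ?s} < m"
        using \<omega> by (intro ballI not_crowdedD) (auto simp: B1_def)
      have b: "\<exists>K\<subseteq>{1..2 ^ j}. card K = m' \<and>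
          (\<forall>a\<in>K. \<forall>b\<in>K. infnorm (X a \<omega> - X b \<omega>) < 1 / (2 * real CARD('d) * 2 ^ i))"
        using B2(3)[of \<omega>] \<omega> unfolding \<rho>_def d_def by blast
      show "focused l \<epsilon> j i \<omega>"
        unfolding focused_def
        by (rule exI[of _ m], rule exI[of _ m']) (use ratio m'0 a b in simp)
    qed
  qed
  moreover have "0 \<le> D" using pos by (simp add: D_def)
  ultimately show ?thesis
    using \<eta>(1,2) unfolding d_def by blast
qed

text \<open>
  The failure probabilities for a given \<open>j\<close> add up to a polynomial in \<open>j\<close> times
  \<open>(2^j) powr (- \<epsilon> / 2)\<close>, because only \<open>i \<le> 2 j\<close> occur; this is summable over \<open>j\<close>.
\<close>

lemma AE_eventually_focused:
  assumes l: "1 \<le> l" and \<epsilon>: "0 < \<epsilon>" "\<epsilon> < 1 / 2"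
  shows "\<exists>\<eta>>0. AE \<omega> in M. \<forall>\<^sub>F j in sequentially. \<forall>i. sparse_cell CARD('d) \<eta> j i \<longrightarrow> focused l \<epsilon> j i \<omega>"
proof -
  obtain \<eta> C J where \<eta>: "0 < \<eta>" "\<eta> \<le> 1" and C: "0 \<le> C"
    and ex: "\<And>j i. J \<le> j \<Longrightarrow> sparse_cell CARD('d) \<eta> j i \<Longrightarrow>
      \<exists>B\<in>events. prob B \<le> C * (1 + ln (2 ^ j)) * (2 ^ j) powr (- (\<epsilon> / 2)) \<and>
        (\<forall>\<omega>\<in>space M - B. focused l \<epsilon> j i \<omega>)"
    using prob_unfocused_le[OF l \<epsilon>] by metis
  define h :: "nat \<Rightarrow> real" where "h j = C * (1 + ln (2 ^ j)) * (2 ^ j) powr (- (\<epsilon> / 2))" for j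
  have h0: "0 \<le> h j" for j using C by (simp add: h_def)
  define I where "I j = {i. J \<le> j \<and> sparse_cell CARD('d) \<eta> j i}" for j
  have I: "I j \<subseteq> {..2 * j}" for j
  proof
    fix i assume "i \<in> I j"
    then have "(2 ^ j) powr (- \<eta>) \<le> (2 ^ j / (2 ^ i) ^ CARD('d) :: real)"
      by (simp add: I_def sparse_cell_def)
    then have "(2 ^ i) ^ CARD('d) \<le> (2 ^ j * (2 ^ j) powr \<eta> :: real)"
      by (simp add: powr_minus field_simps)
    also have "\<dots> \<le> 2 ^ j * (2 ^ j) powr 1"
      using \<eta> by (intro mult_left_mono powr_mono) auto
    finally have a: "(2 ^ i) ^ CARD('d) \<le> (2 :: real) ^ (2 * j)"
      by (simp add: mult_2 power_add)
    have b: "((2 :: real) ^ i) ^ 1 \<le> (2 ^ i) ^ CARD('d)"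
      by (rule power_increasing) (auto simp: Suc_le_eq)
    have "(2 :: real) ^ i \<le> 2 ^ (2 * j)"
      by (rule order_trans[OF b[unfolded power_one_right] a])
    then have "i \<le> 2 * j" by (rule power_le_imp_le_exp[rotated]) simp
    then show "i \<in> {..2 * j}" by simp
  qed
  have finI: "finite (I j)" for j using I by (rule finite_subset) simp
  have "\<forall>j i. \<exists>B. i \<in> I j \<longrightarrow> B \<in> events \<and> prob B \<le> h j \<and> (\<forall>\<omega>\<in>space M - B. focused l \<epsilon> j i \<omega>)"
    using ex unfolding I_def h_def by blast
  then obtain B where B: "\<And>j i. i \<in> I j \<Longrightarrow>
      B j i \<in> events \<and> prob (B j i) \<le> h j \<and> (\<forall>\<omega>\<in>space M - B j i. focused l \<epsilon> j i \<omega>)"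
    by metis
  define A where "A j = (\<Union>i\<in>I j. B j i)" for j
  have A: "A j \<in> events" for j
    unfolding A_def using B finI by (intro sets.finite_UN) auto
  have prob_A: "prob (A j) \<le> real (2 * j + 1) * h j" for j
  proof -
    have "prob (A j) \<le> (\<Sum>i\<in>I j. prob (B j i))"
      unfolding A_def using B finI by (intro finite_measure_subadditive_finite) auto
    also have "\<dots> \<le> real (card (I j)) * h j"
      using B by (intro sum_bounded_above) auto
    also have "\<dots> \<le> real (2 * j + 1) * h j"
      using card_mono[OF _ I[of j]] h0 by (intro mult_right_mono) auto
    finally show ?thesis .
  qed
  have "summable (\<lambda>j. real (2 * j + 1) * h j)"
  proof -
    let ?u = "\<lambda>j. real (2 * j + 1) * ((1 + ln (2 ^ j)) * (2 ^ j) powr (- (\<epsilon> / 2)))"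
    have "?u \<in> O(\<lambda>j. inverse (real j ^ 2))" using \<epsilon>(1) by real_asymp
    moreover have "summable (\<lambda>j. norm (inverse (real j ^ 2)))"
      using inverse_power_summable[of 2, where ?'a = real] by simp
    ultimately have "summable ?u" by (rule summable_comparison_test_bigo[rotated])
    then have "summable (\<lambda>j. C * ?u j)" by (rule summable_mult)
    also have "(\<lambda>j. C * ?u j) = (\<lambda>j. real (2 * j + 1) * h j)"
      by (rule ext) (simp add: h_def)
    finally show ?thesis .
  qed
  then have "summable (\<lambda>j. prob (A j))"
    by (rule summable_comparison_test'[where N = 0]) (simp only: real_norm_def abs_of_nonneg[OF measure_nonneg] prob_A)
  then have "AE \<omega> in M. \<forall>\<^sub>F j in sequentially. \<omega> \<in> space M - A j"
    using A by (intro borel_cantelli_AE1) (auto simp: emeasure_eq_measure)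
  then have "AE \<omega> in M. \<forall>\<^sub>F j in sequentially. \<forall>i. sparse_cell CARD('d) \<eta> j i \<longrightarrow> focused l \<epsilon> j i \<omega>"
  proof (rule AE_mp, intro AE_I2 impI)
    fix \<omega> assume "\<forall>\<^sub>F j in sequentially. \<omega> \<in> space M - A j"
    then show "\<forall>\<^sub>F j in sequentially. \<forall>i. sparse_cell CARD('d) \<eta> j i \<longrightarrow> focused l \<epsilon> j i \<omega>"
      using eventually_ge_at_top[of J]
    proof eventually_elim
      case (elim j)
      then show ?case using B by (auto simp: A_def I_def)
    qed
  qed
  with \<eta> show ?thesis by blast
qed

lemma chromatic_numbers_in_focused_cell:
  assumes p: "1 \<le> p" and l: "1 \<le> l" and \<epsilon>: "0 < \<epsilon>" "\<epsilon> < 1 / 2" and foc: "focused l \<epsilon> j i \<omega>"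
    and dist: "\<And>a b. 1 \<le> a \<Longrightarrow> 1 \<le> b \<Longrightarrow> a \<noteq> b \<Longrightarrow> X a \<omega> \<noteq> X b \<omega>"
    and n: "2 ^ j \<le> n" "n \<le> 2 * 2 ^ j" and \<rho>: "1 / (2 * 2 ^ i) \<le> \<rho>" "\<rho> \<le> 1 / 2 ^ i"
  shows "1 \<le> real (distant_chromatic_number l (rgg_verts X n \<omega>) (rgg_adj p \<rho>))
      / real (chromatic_number (rgg_verts X n \<omega>) (rgg_adj p \<rho>))"
    and "real (distant_chromatic_number l (rgg_verts X n \<omega>) (rgg_adj p \<rho>))
      / real (chromatic_number (rgg_verts X n \<omega>) (rgg_adj p \<rho>)) \<le> (1 + 2 * \<epsilon>) / (1 - 2 * \<epsilon>)"
proof -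
  let ?V = "rgg_verts X n \<omega>"
  define \<kappa> where "\<kappa> = chromatic_number ?V (rgg_adj p \<rho>)"
  define \<kappa>l where "\<kappa>l = distant_chromatic_number l ?V (rgg_adj p \<rho>)"
  have V: "finite ?V" by (simp add: rgg_verts_def)
  have "0 < 1 / (2 * 2 ^ i :: real)" by simp
  then have \<rho>0: "0 < \<rho>" using \<rho>(1) by (rule less_le_trans)
  from foc[unfolded focused_def] obtain m m' K where mm': "0 < m'"
      "real m \<le> (1 + 2 * \<epsilon>) / (1 - 2 * \<epsilon>) * real m'"
    and crowd: "\<forall>a\<in>{1..2 * 2 ^ j}.
        card {b\<in>{1..2 * 2 ^ j} - {a}. infnorm (X b \<omega> - X a \<omega>) \<le> real l / 2 ^ i} < m"
    and K: "K \<subseteq> {1..2 ^ j}" "card K = m'"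
      "\<forall>a\<in>K. \<forall>b\<in>K. infnorm (X a \<omega> - X b \<omega>) < 1 / (2 * real CARD('d) * 2 ^ i)"
    by (elim exE conjE) (rule that)
  have "\<kappa>l \<le> m"
    unfolding \<kappa>l_def
  proof (rule distant_chromatic_number_rgg_le[OF p V])
    fix u assume "u \<in> ?V"
    then obtain a where a: "a \<in> {1..n}" "u = X a \<omega>" by (auto simp: rgg_verts_def)
    let ?S = "{b\<in>{1..2 * 2 ^ j} - {a}. infnorm (X b \<omega> - X a \<omega>) \<le> real l / 2 ^ i}"
    have le: "real l * \<rho> \<le> real l / 2 ^ i"
      using mult_left_mono[OF \<rho>(2), of "real l"] by simp
    have "{v \<in> ?V. v \<noteq> u \<and> infnorm (v - u) \<le> real l * \<rho>} \<subseteq> (\<lambda>b. X b \<omega>) ` ?S"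
    proof
      fix v assume "v \<in> {v \<in> ?V. v \<noteq> u \<and> infnorm (v - u) \<le> real l * \<rho>}"
      then obtain b where "b \<in> {1..n}" "v = X b \<omega>" "v \<noteq> u" "infnorm (v - u) \<le> real l * \<rho>"
        by (auto simp: rgg_verts_def)
      then have "b \<in> ?S" using a n le by auto
      then show "v \<in> (\<lambda>b. X b \<omega>) ` ?S" using \<open>v = X b \<omega>\<close> by (rule rev_image_eqI)
    qed
    then have "card {v \<in> ?V. v \<noteq> u \<and> infnorm (v - u) \<le> real l * \<rho>} \<le> card ((\<lambda>b. X b \<omega>) ` ?S)"
      by (intro card_mono) auto
    also have "\<dots> \<le> card ?S" by (rule card_image_le) simp
    also have "\<dots> < m" using a n by (intro crowd[rule_format]) auto
    finally show "card {v \<in> ?V. v \<noteq> u \<and> infnorm (v - u) \<le> real l * \<rho>} < m" .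
  qed (use \<rho>0 in simp)
  have K1: "K \<subseteq> {1..n}" using K(1) n(1) by auto
  have "m' \<le> \<kappa>"
  proof -
    have "inj_on (\<lambda>a. X a \<omega>) K"
      using dist K1 by (intro inj_onI) (metis atLeastAtMost_iff subsetD)
    then have "m' = card ((\<lambda>a. X a \<omega>) ` K)" using K(2) by (simp add: card_image)
    also have "\<dots> \<le> \<kappa>"
      unfolding \<kappa>_def
    proof (rule card_le_chromatic_number_rgg[OF p V])
      show "(\<lambda>a. X a \<omega>) ` K \<subseteq> ?V" using K1 by (auto simp: rgg_verts_def)
      fix x y assume "x \<in> (\<lambda>a. X a \<omega>) ` K" "y \<in> (\<lambda>a. X a \<omega>) ` K"
      then have "infnorm (x - y) < 1 / (2 * real CARD('d) * 2 ^ i)" using K(3) by auto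
      then have "real CARD('d) * infnorm (x - y) < real CARD('d) * (1 / (2 * real CARD('d) * 2 ^ i))"
        by (intro mult_strict_left_mono) auto
      also have "\<dots> = 1 / (2 * 2 ^ i)" by simp
      finally show "real CARD('d) * infnorm (x - y) < \<rho>" using \<rho>(1) by simp
    qed
    finally show ?thesis .
  qed
  have "\<kappa> \<le> \<kappa>l"
    unfolding \<kappa>_def \<kappa>l_def using V l by (intro chromatic_number_le_distant) (auto simp: rgg_adj_def)
  have \<kappa>0: "0 < \<kappa>" using mm'(1) \<open>m' \<le> \<kappa>\<close> by simp
  show "1 \<le> real \<kappa>l / real \<kappa>" using \<kappa>0 \<open>\<kappa> \<le> \<kappa>l\<close> by simp
  have "real \<kappa>l \<le> real m" using \<open>\<kappa>l \<le> m\<close> by simp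
  also have "\<dots> \<le> (1 + 2 * \<epsilon>) / (1 - 2 * \<epsilon>) * real \<kappa>"
    using \<epsilon> \<open>m' \<le> \<kappa>\<close> by (intro order_trans[OF mm'(2)] mult_left_mono) auto
  finally show "real \<kappa>l / real \<kappa> \<le> (1 + 2 * \<epsilon>) / (1 - 2 * \<epsilon>)"
    using \<kappa>0 by (simp add: divide_le_eq)
qed

end

text \<open>
  Passing from \<open>(n, r n)\<close> to the corner of its dyadic cell changes \<open>n r^d\<close> at most by a factor
  depending on the dimension, which the limits in the hypotheses absorb.
\<close>

lemma eventually_in_sparse_cell:
  fixes r :: "nat \<Rightarrow> real"
  assumes r_pos: "\<And>n. 1 \<le> n \<Longrightarrow> 0 < r n" and r_tendsto: "r \<longlonglongrightarrow> 0"
    and upper: "(\<lambda>n. real n * r n ^ d / ln (real n)) \<longlonglongrightarrow> 0"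
    and lower: "\<And>\<epsilon>::real. 0 < \<epsilon> \<Longrightarrow> (\<lambda>n. real n powr (- \<epsilon>) / (real n * r n ^ d)) \<longlonglongrightarrow> 0"
    and \<eta>: "0 < \<eta>"
  shows "\<forall>\<^sub>F n in sequentially. \<exists>j i. j0 \<le> j \<and> 2 ^ j \<le> n \<and> n \<le> 2 * 2 ^ j \<and>
    1 / (2 * 2 ^ i) \<le> r n \<and> r n \<le> 1 / 2 ^ i \<and> sparse_cell d \<eta> j i"
proof -
  have "\<forall>\<^sub>F n in sequentially. real n * r n ^ d / ln (real n) < \<eta> / (2 * 2 ^ d)"
    using \<eta> by (intro order_tendstoD(2)[OF upper]) auto
  moreover have "\<forall>\<^sub>F n in sequentially. real n powr (- \<eta>) / (real n * r n ^ d) < 1 / (2 * 2 powr \<eta>)"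
    by (intro order_tendstoD(2)[OF lower[OF \<eta>]]) auto
  moreover have "\<forall>\<^sub>F n in sequentially. r n < 1"
    by (intro order_tendstoD(2)[OF r_tendsto]) auto
  ultimately show ?thesis
    using eventually_ge_at_top[of "2 ^ (j0 + 1)"]
  proof eventually_elim
    case (elim n)
    have "(2 :: nat) ^ 1 \<le> 2 ^ (j0 + 1)" by (intro power_increasing) auto
    from order_trans[OF this elim(4)] have n2: "2 \<le> n" by simp
    have r0: "0 < r n" using r_pos n2 by simp
    obtain j where j: "2 ^ j \<le> n" "n < 2 ^ (j + 1)"
      using ex_power_ivl1[of 2 n] n2 by auto
    have "(2 :: nat) ^ (j0 + 1) < 2 ^ (j + 1)" using elim(4) j(2) by (rule le_less_trans)
    then have jj: "j0 < j" by simp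
    \<comment> \<open>The least exponent gives \<open>2^(-k) < r n \<le> 2^(1-k)\<close>, so \<open>i = k - 1\<close>; \<open>r n < 1\<close> excludes \<open>k = 0\<close>.\<close>
    define k where "k = (LEAST k. (1 / 2) ^ k < r n)"
    have "\<exists>k. (1 / 2) ^ k < r n" using real_arch_pow_inv[OF r0, of "1 / 2"] by simp
    then have k: "(1 / 2) ^ k < r n" unfolding k_def by (rule LeastI_ex)
    have k': "\<not> (1 / 2) ^ k' < r n" if "k' < k" for k'
      using that unfolding k_def by (rule not_less_Least)
    have "k \<noteq> 0" using k elim(3) by (intro notI) simp
    then obtain i where i: "k = Suc i" by (cases k) auto
    have ri: "1 / (2 * 2 ^ i) \<le> r n" "r n \<le> 1 / 2 ^ i"
      using k k'[of i] by (simp_all add: i power_one_over)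
    define N where "N = (2 :: real) ^ j"
    define \<Lambda> where "\<Lambda> = N / (2 ^ i) ^ d"
    define \<mu> where "\<mu> = real n * r n ^ d"
    have \<mu>0: "0 < \<mu>" using r0 n2 by (simp add: \<mu>_def)
    have "real n < real (2 ^ (j + 1))" using j(2) by (simp only: of_nat_less_iff)
    then have n: "N \<le> real n" "real n \<le> 2 * N" using j(1) by (simp_all add: N_def)
    have N2: "2 \<le> N" using jj power_increasing[of 1 j "2::real"] by (simp add: N_def)
    have "\<Lambda> \<le> \<eta> * ln N"
    proof -
      have "\<Lambda> = N * (1 / 2 ^ i) ^ d" by (simp add: \<Lambda>_def power_divide)
      also have "\<dots> \<le> real n * (2 * r n) ^ d"
        using n ri N2 by (intro mult_mono power_mono) (auto simp: field_simps)
      also have "\<dots> = 2 ^ d * \<mu>" by (simp add: \<mu>_def power_mult_distrib)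
      also have "\<dots> \<le> 2 ^ d * (\<eta> / (2 * 2 ^ d) * ln (real n))"
        using elim(1) n2 by (intro mult_left_mono) (auto simp: \<mu>_def divide_less_eq)
      also have "\<dots> = \<eta> / 2 * ln (real n)" by simp
      also have "\<dots> \<le> \<eta> / 2 * (2 * ln N)"
      proof (rule mult_left_mono)
        have "real n \<le> N * N" using n N2 mult_right_mono[of 2 N N] by linarith
        then have "ln (real n) \<le> ln (N * N)" using n2 N2 by simp
        then show "ln (real n) \<le> 2 * ln N" using N2 by (simp add: ln_mult)
      qed (use \<eta> in auto)
      finally show ?thesis by simp
    qed
    moreover have "N powr (- \<eta>) \<le> \<Lambda>"
    proof -
      have "N powr (- \<eta>) \<le> (real n / 2) powr (- \<eta>)"
        using n n2 \<eta> by (intro powr_mono2') auto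
      also have "\<dots> = 2 powr \<eta> * real n powr (- \<eta>)"
        using n2 by (simp add: powr_divide powr_minus field_simps)
      also have "\<dots> \<le> 2 powr \<eta> * (1 / (2 * 2 powr \<eta>) * \<mu>)"
        using elim(2) \<mu>0 by (intro mult_left_mono) (auto simp: \<mu>_def divide_less_eq)
      also have "\<dots> = real n / 2 * r n ^ d" by (simp add: \<mu>_def)
      also have "\<dots> \<le> N * (1 / 2 ^ i) ^ d"
        using n ri r0 N2 by (intro mult_mono power_mono) auto
      also have "\<dots> = \<Lambda>" by (simp add: \<Lambda>_def power_divide)
      finally show ?thesis .
    qed
    ultimately have "sparse_cell d \<eta> j i" by (simp add: sparse_cell_def \<Lambda>_def N_def)
    with j jj ri show ?case
      by (intro exI[of _ j] exI[of _ i]) auto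
  qed
qed

lemma measure_density_ball_le:
  fixes f :: "real ^ 'd \<Rightarrow> real"
  assumes f: "f \<in> borel_measurable borel" and bound: "\<And>x. f x \<le> F" and F: "0 \<le> F" and s: "0 \<le> s"
  shows "measure (density lborel f) {y. infnorm (y - x) \<le> s} \<le> F * (2 * s) ^ CARD('d)"
proof -
  let ?a = "\<chi> i. x $ i - s" and ?b = "\<chi> i. x $ i + s"
  have box: "{y. infnorm (y - x) \<le> s} = cbox ?a ?b"
    by (auto simp: infnorm_le_iff_cart mem_box_cart abs_le_iff algebra_simps)
  have "cbox ?a ?b \<noteq> {}"
    using s by (auto simp: interval_eq_empty_cart not_less)
  then have content: "measure lborel (cbox ?a ?b) = (2 * s) ^ CARD('d)"
    by (subst content_cbox_cart) (simp_all add: algebra_simps)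
  have "emeasure (density lborel f) (cbox ?a ?b) = (\<integral>\<^sup>+ y. ennreal (f y) * indicator (cbox ?a ?b) y \<partial>lborel)"
    using f by (intro emeasure_density) auto
  also have "\<dots> \<le> (\<integral>\<^sup>+ y. ennreal F * indicator (cbox ?a ?b) y \<partial>lborel)"
    by (intro nn_integral_mono mult_right_mono ennreal_leI bound) auto
  also have "\<dots> = ennreal F * emeasure lborel (cbox ?a ?b)"
    by (intro nn_integral_cmult_indicator) auto
  also have "emeasure lborel (cbox ?a ?b) = ennreal ((2 * s) ^ CARD('d))"
    unfolding content[symmetric]
    by (intro emeasure_eq_ennreal_measure) (use emeasure_lborel_cbox_finite[of ?a ?b] in auto)
  also have "ennreal F * \<dots> = ennreal (F * (2 * s) ^ CARD('d))"
    using F s by (simp add: ennreal_mult)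
  finally have "emeasure (density lborel f) (cbox ?a ?b) \<le> ennreal (F * (2 * s) ^ CARD('d))" .
  then show ?thesis
    unfolding box using F s by (simp add: measure_def enn2real_leI)
qed

theorem theorem4:
  fixes p :: ereal
    and f :: "real ^ 'd \<Rightarrow> real"
    and M :: "'w measure"
    and X :: "nat \<Rightarrow> 'w \<Rightarrow> real ^ 'd"
    and r :: "nat \<Rightarrow> real"
    and l :: nat
  assumes p: "1 \<le> p"
    and f_measurable: "f \<in> borel_measurable borel"
    and f_nonneg: "\<And>x. 0 \<le> f x"
    and f_density: "(\<integral>\<^sup>+ x. ennreal (f x) \<partial>lborel) = 1"
    and f_bounded: "bounded (range f)"
    and M: "prob_space M"
    and X_indep: "prob_space.indep_vars M (\<lambda>_. borel) X {1..}"
    and X_density: "\<And>i. 1 \<le> i \<Longrightarrow> distributed M lborel (X i) (\<lambda>x. ennreal (f x))"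
    and r_pos: "\<And>n. 1 \<le> n \<Longrightarrow> 0 < r n"
    and r_tendsto: "r \<longlonglongrightarrow> 0"
    and l: "1 \<le> l"
    and upper: "(\<lambda>n. real n * r n ^ CARD('d) / ln (real n)) \<longlonglongrightarrow> 0"
    and lower: "\<And>\<epsilon>::real. 0 < \<epsilon> \<Longrightarrow>
      (\<lambda>n. real n powr (- \<epsilon>) / (real n * r n ^ CARD('d))) \<longlonglongrightarrow> 0"
  shows "AE \<omega> in M.
    (\<lambda>n. real (distant_chromatic_number l (rgg_verts X n \<omega>) (rgg_adj p (r n)))
         / real (chromatic_number (rgg_verts X n \<omega>) (rgg_adj p (r n)))) \<longlonglongrightarrow> 1"
proof -
  obtain F where F: "1 \<le> F" "\<And>x. f x \<le> F"
  proof -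
    obtain b where "\<And>x. \<bar>f x\<bar> \<le> b" using f_bounded by (auto simp: bounded_iff)
    then show ?thesis by (intro that[of "max 1 b"]) (auto simp: abs_le_iff le_max_iff_disj)
  qed
  define P where "P = density lborel (\<lambda>x. ennreal (f x))"
  interpret prob_space M by (rule M)
  have distr: "distr M borel (X a) = P" if "1 \<le> a" for a
    using distributed_distr_eq_density[OF X_density[OF that]] unfolding P_def
    by (simp cong: distr_cong)
  interpret P: prob_space P
    using f_density f_measurable unfolding P_def by (intro prob_spaceI) (simp add: emeasure_density)
  interpret iid_bounded_sample M P X F
  proof unfold_locales
    show "indep_vars (\<lambda>_. borel) X {1..}" by (rule X_indep)
    show "distr M borel (X a) = P" if "1 \<le> a" for a using distr that .
    show "measure P {y. infnorm (y - x) \<le> s} \<le> F * (2 * s) ^ CARD('d)" if "0 \<le> s" for x s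
      unfolding P_def using f_measurable F that by (intro measure_density_ball_le) auto
  qed (rule F(1))
  define \<epsilon> :: "nat \<Rightarrow> real" where "\<epsilon> q = 1 / (real q + 3)" for q
  have \<epsilon>: "0 < \<epsilon> q" "\<epsilon> q < 1 / 2" for q by (auto simp: \<epsilon>_def field_simps)
  define R where "R n \<omega> = real (distant_chromatic_number l (rgg_verts X n \<omega>) (rgg_adj p (r n)))
         / real (chromatic_number (rgg_verts X n \<omega>) (rgg_adj p (r n)))" for n \<omega>
  have "AE \<omega> in M. \<forall>\<^sub>F n in sequentially. 1 \<le> R n \<omega> \<and> R n \<omega> \<le> (1 + 2 * \<epsilon> q) / (1 - 2 * \<epsilon> q)" for q
  proof -
    obtain \<eta> where \<eta>: "0 < \<eta>" and "AE \<omega> in M. \<forall>\<^sub>F j in sequentially.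
        \<forall>i. sparse_cell CARD('d) \<eta> j i \<longrightarrow> focused l (\<epsilon> q) j i \<omega>"
      using AE_eventually_focused[OF l \<epsilon>] by blast
    from this(2) AE_distinct_points show ?thesis
    proof eventually_elim
      case (elim \<omega>)
      then obtain j0 where j0: "\<And>j i. j0 \<le> j \<Longrightarrow> sparse_cell CARD('d) \<eta> j i \<Longrightarrow> focused l (\<epsilon> q) j i \<omega>"
        unfolding eventually_sequentially by blast
      have "\<forall>\<^sub>F n in sequentially. \<exists>j i. j0 \<le> j \<and> 2 ^ j \<le> n \<and> n \<le> 2 * 2 ^ j \<and>
          1 / (2 * 2 ^ i) \<le> r n \<and> r n \<le> 1 / 2 ^ i \<and> sparse_cell CARD('d) \<eta> j i"
        by (rule eventually_in_sparse_cell[OF r_pos r_tendsto upper lower \<eta>])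
      then show ?case
      proof eventually_elim
        case (elim n)
        then obtain j i where "2 ^ j \<le> n" "n \<le> 2 * 2 ^ j" "1 / (2 * 2 ^ i) \<le> r n" "r n \<le> 1 / 2 ^ i"
          "focused l (\<epsilon> q) j i \<omega>" using j0 by blast
        then show ?case
          unfolding R_def using \<open>\<forall>a\<ge>1. \<forall>b\<ge>1. a \<noteq> b \<longrightarrow> X a \<omega> \<noteq> X b \<omega>\<close>
          by (intro conjI chromatic_numbers_in_focused_cell[OF p l \<epsilon>]) auto
      qed
    qed
  qed
  then have "AE \<omega> in M. \<forall>q. \<forall>\<^sub>F n in sequentially. 1 \<le> R n \<omega> \<and> R n \<omega> \<le> (1 + 2 * \<epsilon> q) / (1 - 2 * \<epsilon> q)"
    by (simp add: AE_all_countable)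
  then have "AE \<omega> in M. (\<lambda>n. R n \<omega>) \<longlonglongrightarrow> 1"
  proof (rule AE_mp, intro AE_I2 impI)
    fix \<omega> assume *: "\<forall>q. \<forall>\<^sub>F n in sequentially. 1 \<le> R n \<omega> \<and> R n \<omega> \<le> (1 + 2 * \<epsilon> q) / (1 - 2 * \<epsilon> q)"
    have lim: "(\<lambda>q. (1 + 2 * \<epsilon> q) / (1 - 2 * \<epsilon> q)) \<longlonglongrightarrow> 1"
      unfolding \<epsilon>_def by real_asymp
    show "(\<lambda>n. R n \<omega>) \<longlonglongrightarrow> 1"
    proof (rule order_tendstoI)
      fix a :: real assume "a < 1"
      show "\<forall>\<^sub>F n in sequentially. a < R n \<omega>"
        using *[rule_format, of 0] by eventually_elim (use \<open>a < 1\<close> in auto)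
    next
      fix a :: real assume "1 < a"
      from order_tendstoD(2)[OF lim this] obtain q where q: "(1 + 2 * \<epsilon> q) / (1 - 2 * \<epsilon> q) < a"
        by (auto simp: eventually_sequentially)
      show "\<forall>\<^sub>F n in sequentially. R n \<omega> < a"
        using *[rule_format, of q] by eventually_elim (use q in auto)
    qed
  qed
  then show ?thesis by (simp add: R_def)
qed

end
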